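(* Let $n\ge 3$. (i) Let $\alpha_3,\alpha_4,\ldots,\alpha_n$ be arbitrary real numbers and set $$\beta_3=-\alpha_3^2+\tfrac14,\qquad \beta_m=-\alpha_m^2+\left(\alpha_{m-1}-\tfrac12\right)^2,\quad m=4,\ldots,n.$$ Then for every $u\in C_0^\infty(\mathbb{R}^n)$, $$\int_{\mathbb{R}^n}|\nabla u|^2\,dx\ \ge\ \int_{\mathbb{R}^n}\left(\frac{\beta_3}{|\mathbf{X_3}|^2}+\ldots+\frac{\beta_n}{|\mathbf{X_n}|^2}\right)u^2\,dx.$$ (ii) Suppose that $\beta_3,\beta_4,\ldots,\beta_n$ are real numbers such that $$\int_{\mathbb{R}^n}|\nabla u|^2\,dx\ \ge\ \int_{\mathbb{R}^n}\left(\frac{\beta_3}{|\mathbf{X_3}|^2}+\ldots+\frac{\beta_n}{|\mathbf{X_n}|^2}\right)u^2\,dx$$ holds for every $u\in C_0^\infty(\mathbb{R}^n)$. Then there exist nonpositive real constants $\alpha_3,\ldots,\alpha_n$ such that $$\beta_3=-\alpha_3^2+\tfrac14,\qquad \beta_m=-\alpha_m^2+\left(\alpha_{m-1}-\tfrac12\right)^2,\quad m=4,\ldots,n.$$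
   Context: For $x=(x_1,\ldots,x_n)\in\mathbb{R}^n$ and $1\le k\le n$, $\mathbf{X_k}:=(x_1,\ldots,x_k,0,\ldots,0)$, so $|\mathbf{X_k}|=(x_1^2+\ldots+x_k^2)^{1/2}$ is the distance of $x$ from the codimension-$k$ subspace $\{x_1=\ldots=x_k=0\}$; in particular $|\mathbf{X_n}|=|x|$. Functions are real valued. When $n=3$ only $\alpha_3$ and $\beta_3$ occur. *)

theory Defs
  imports "HOL-Analysis.Analysis"
begin

definition partial :: "'n \<Rightarrow> (real ^ 'n \<Rightarrow> real) \<Rightarrow> real ^ 'n \<Rightarrow> real" where
  "partial i u x = frechet_derivative u (at x) (axis i 1)"

definition grad :: "(real ^ 'n \<Rightarrow> real) \<Rightarrow> real ^ 'n \<Rightarrow> real ^ 'n" where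
  "grad u x = (\<chi> i. partial i u x)"

text \<open>\<open>frechet_derivative\<close> is only meaningful at points of differentiability, so
  differentiability is required explicitly at every order.\<close>

primrec Ck :: "nat \<Rightarrow> (real ^ 'n \<Rightarrow> real) \<Rightarrow> bool" where
  "Ck 0 u \<longleftrightarrow> continuous_on UNIV u"
| "Ck (Suc k) u \<longleftrightarrow> (\<forall>x. u differentiable (at x)) \<and> (\<forall>i. Ck k (partial i u))"

definition smooth :: "(real ^ 'n \<Rightarrow> real) \<Rightarrow> bool" where
  "smooth u \<longleftrightarrow> (\<forall>k. Ck k u)"

definition Cc_infinity :: "(real ^ 'n \<Rightarrow> real) set" where
  "Cc_infinity = {u. smooth u \<and> compact (closure {x. u x \<noteq> 0})}"

text \<open>The index type \<open>'n\<close> carries no order, so the ordering of the coordinates is given by an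
  enumeration \<open>e\<close> of \<open>'n\<close> by \<open>{1..n}\<close>: the coordinate \<open>x\<^sub>j\<close> is \<open>x $ e j\<close>, and
  \<open>proj_first e k x\<close> is \<open>(x\<^sub>1, \<dots>, x\<^sub>k, 0, \<dots>, 0)\<close>.\<close>

definition proj_first :: "(nat \<Rightarrow> 'n) \<Rightarrow> nat \<Rightarrow> real ^ 'n \<Rightarrow> real ^ 'n" where
  "proj_first e k x = (\<chi> i. if i \<in> e ` {1..k} then x $ i else 0)"

end

theory Submission
  imports Defs
begin

text \<open>Let \<open>\<phi> = \<Prod>\<^sub>m |X\<^sub>m|\<^bsup>a\<^sub>m\<^esup>\<close> with \<open>a\<^sub>m = \<alpha>\<^sub>m\<^sub>-\<^sub>1 - \<alpha>\<^sub>m - 1/2\<close> and \<open>\<alpha>\<^sub>2 = 0\<close>. Then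
  \<open>- \<Delta>\<phi>/\<phi> = \<Sum>\<^sub>m \<beta>\<^sub>m/|X\<^sub>m|\<^sup>2\<close>, so \<open>\<integral>|\<nabla>u|\<^sup>2 - \<integral>\<Sum>\<^sub>m \<beta>\<^sub>m u\<^sup>2/|X\<^sub>m|\<^sup>2 = \<integral>|\<nabla>u - u \<nabla>\<phi>/\<phi>|\<^sup>2\<close>, which is nonnegative.
  Conversely, the \<open>\<alpha>\<^sub>m\<close> are found one after another. If \<open>\<beta>\<^sub>k > (\<alpha>\<^sub>k\<^sub>-\<^sub>1 - 1/2)\<^sup>2\<close>, take the function \<open>\<phi>\<close> built from
  \<open>\<alpha>\<^sub>3, \<dots>, \<alpha>\<^sub>k\<^sub>-\<^sub>1\<close> and \<open>\<alpha>\<^sub>k = - 1/N\<close>, times a bump function supported away from \<open>X\<^sub>k\<^sub>+\<^sub>1 = 0\<close>. As \<open>N \<rightarrow> \<infinity>\<close> the integral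
  \<open>\<integral>\<phi>\<^sup>2/|X\<^sub>k|\<^sup>2\<close> near \<open>X\<^sub>k = 0\<close> grows like \<open>N\<close>, while all other contributions to the energy
  stay bounded. Replacing \<open>|X\<^sub>m|\<^sup>2\<close> by \<open>|X\<^sub>m|\<^sup>2 + \<epsilon>\<close> makes every function smooth.\<close>

section \<open>Integration by parts\<close>

text \<open>The exponents are chosen through their partial sums: \<open>a 3 + ... + a m\<close> is
  \<open>- \<alpha> m - (m - 2) / 2\<close>, the degree of \<phi> transversally to X_m = 0. At
  degree \<open>- (m - 2) / 2\<close> the integral of \<phi>^2/|X_m|^2 just diverges, and
  \<open>\<alpha> m < 0\<close> is the integrable side. Hence the nonpositive parameters in the
  converse, the growth like N at -1/N, and the need to approach the value 0 through strictly
  negative ones. The obstacle is the limit \<epsilon> -> 0 under the integral. The potential is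
  dominated by a multiple of 1/|X_3|^2, locally integrable because 3 > 2; this settles the first
  half. In the second half the weight \<phi>^2 is singular as well and is compared with a product of
  powers |x_i|^(-c), c < 1. For the limit at fixed N the constant c may depend on N, whereas the
  final estimate must hold with one c for all N. It does, because there \<phi>^2 appears without the
  factor 1/|X_3|^2.\<close>

lemma partial_eq:
  assumes "(f has_derivative f') (at x)"
  shows "partial i f x = f' (axis i 1)"
  using frechet_derivative_at[OF assms] by (simp add: partial_def)

lemma has_derivative_grad:
  fixes f :: "real ^ 'n \<Rightarrow> real"
  assumes "f differentiable (at x)"
  shows "(f has_derivative (\<lambda>h. grad f x \<bullet> h)) (at x)"
proof -
  let ?f' = "frechet_derivative f (at x)"
  have f': "(f has_derivative ?f') (at x)"
    using assms frechet_derivative_works by blast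
  have "?f' h = grad f x \<bullet> h" for h
  proof -
    have "?f' h = ?f' (\<Sum>i\<in>UNIV. h $ i *\<^sub>R axis i 1)"
      using basis_expansion[of h] by (simp add: scalar_mult_eq_scaleR)
    also have "\<dots> = (\<Sum>i\<in>UNIV. h $ i * ?f' (axis i 1))"
      using has_derivative_linear[OF f'] by (simp add: linear_sum linear_cmul)
    finally show ?thesis
      by (simp add: grad_def partial_def inner_vec_def mult.commute)
  qed
  then have "?f' = (\<lambda>h. grad f x \<bullet> h)" by blast
  with f' show ?thesis by simp
qed

text \<open>The regularity that integration by parts uses. For the quotients built from
  \<open>u\<close> in \<open>integral_parts_radial\<close> it is checked from a single gradient
  formula, with no derivatives of higher order.\<close>

definition C1c :: "(real ^ 'n \<Rightarrow> real) \<Rightarrow> bool" where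
  "C1c u \<longleftrightarrow> (\<forall>x. u differentiable (at x)) \<and> (\<forall>i. continuous_on UNIV (partial i u)) \<and>
    bounded {x. u x \<noteq> 0}"

lemma Cc_infinity_C1c:
  assumes "u \<in> Cc_infinity"
  shows "C1c u"
proof -
  have "Ck (Suc 0) u" and "compact (closure {x. u x \<noteq> 0})"
    using assms by (auto simp: Cc_infinity_def smooth_def)
  moreover from this(2) have "bounded {x. u x \<noteq> 0}"
    by (rule bounded_subset[OF compact_imp_bounded closure_subset])
  ultimately show ?thesis by (auto simp: C1c_def)
qed

lemma C1cI:
  fixes u :: "real ^ 'n \<Rightarrow> real"
  assumes "\<And>x. (u has_derivative (\<lambda>h. g x \<bullet> h)) (at x)"
    and "continuous_on UNIV g" "bounded {x. u x \<noteq> 0}"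
  shows "C1c u" "grad u = g"
proof -
  have p: "partial i u = (\<lambda>x. g x $ i)" for i
    using partial_eq[OF assms(1)] by (auto simp: inner_axis fun_eq_iff)
  show "C1c u"
    unfolding C1c_def p using assms by (auto simp: differentiable_def intro!: continuous_intros)
  show "grad u = g" by (simp add: grad_def p fun_eq_iff vec_eq_iff)
qed

lemma C1cD:
  fixes u :: "real ^ 'n \<Rightarrow> real"
  assumes "C1c u"
  shows "(u has_derivative (\<lambda>h. grad u x \<bullet> h)) (at x)"
    and "continuous_on UNIV (grad u)" and "continuous_on UNIV u"
    and "\<exists>R>0. \<forall>x. (u x \<noteq> 0 \<or> grad u x \<noteq> 0) \<longrightarrow> x \<in> cball 0 R"
proof -
  show D: "(u has_derivative (\<lambda>h. grad u x \<bullet> h)) (at x)" for x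
    using assms has_derivative_grad unfolding C1c_def by blast
  show "continuous_on UNIV (grad u)"
    unfolding grad_def using assms
    by (intro continuous_on_vec_lambda) (auto simp: C1c_def)
  show "continuous_on UNIV u"
    by (intro continuous_at_imp_continuous_on ballI has_derivative_continuous[OF D])
  obtain R where R: "R > 0" "\<And>x. u x \<noteq> 0 \<Longrightarrow> norm x \<le> R"
    using assms unfolding C1c_def bounded_pos by auto
  have "grad u x = 0" if "norm x > R" for x
  proof -
    \<comment> \<open>\<open>u\<close> vanishes on the open complement of the closed ball, so one
      ball serves for \<open>u\<close> and its gradient.\<close>
    have "(u has_derivative (\<lambda>h. 0)) (at x)"
    proof (rule has_derivative_transform_within_open[of "\<lambda>_. 0" _ x UNIV "- cball 0 R"])
      show "open (- cball (0 :: real ^ 'n) R)" by (simp add: open_Compl)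
    qed (use that R in force)+
    then have "partial i u x = 0" for i
      using partial_eq by metis
    then show ?thesis by (simp add: grad_def vec_eq_iff)
  qed
  then show "\<exists>R>0. \<forall>x. (u x \<noteq> 0 \<or> grad u x \<noteq> 0) \<longrightarrow> x \<in> cball 0 R"
    using R by (intro exI[of _ R]) (metis mem_cball_0 not_less)
qed

lemma integrable_continuous_cball:
  fixes f :: "'a::euclidean_space \<Rightarrow> real"
  assumes "continuous_on UNIV f" "\<And>x. f x \<noteq> 0 \<Longrightarrow> x \<in> cball 0 R"
  shows "integrable lborel f"
proof -
  have "integrable lborel (\<lambda>x. indicator (cball 0 R) x *\<^sub>R f x)"
    using assms(1) by (intro borel_integrable_compact) (auto intro: continuous_on_subset)
  moreover have "(\<lambda>x. indicator (cball 0 R) x *\<^sub>R f x) = f"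
    proof
    fix x show "indicator (cball 0 R) x *\<^sub>R f x = f x"
      using assms(2)[of x] by (cases "f x = 0") auto
  qed
  ultimately show ?thesis by simp
qed

text \<open>Translation invariance gives difference quotients of integral zero; they converge
  dominatedly to the partial derivative.\<close>

lemma integral_partial_eq_0:
  fixes g :: "real ^ 'n \<Rightarrow> real"
  assumes "C1c g"
  shows "(\<integral>x. grad g x $ i \<partial>lborel) = 0"
proof -
  note D = C1cD[OF assms]
  let ?v = "axis i 1 :: real ^ 'n"
  obtain R where R: "R > 0" "\<And>x. g x \<noteq> 0 \<or> grad g x \<noteq> 0 \<Longrightarrow> x \<in> cball 0 R"
    using D(4) by blast
  obtain M where M: "\<And>x. x \<in> cball 0 R \<Longrightarrow> norm (grad g x) \<le> M"
  proof -
    have "compact (grad g ` cball 0 R)"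
      using D(2) continuous_on_subset by (intro compact_continuous_image) auto
    then show ?thesis using that by (meson bounded_iff compact_imp_bounded imageI)
  qed
  have "norm (grad g 0) \<le> M" using M[of 0] R(1) by simp
  then have "M \<ge> 0" using norm_ge_zero[of "grad g 0"] by linarith
  have M': "\<bar>grad g x $ i\<bar> \<le> M" for x
  proof (cases "grad g x = 0")
    case False
    then show ?thesis
      using M[of x] R(2)[of x] component_le_norm_cart[of "grad g x" i] by linarith
  qed (use \<open>M \<ge> 0\<close> in simp)
  have line: "((\<lambda>t. g (x + t *\<^sub>R ?v)) has_real_derivative grad g (x + t *\<^sub>R ?v) $ i) (at t)" for x t
  proof -
    have "((\<lambda>t. g (x + t *\<^sub>R ?v)) has_derivative (\<lambda>h. grad g (x + t *\<^sub>R ?v) \<bullet> (h *\<^sub>R ?v))) (at t)"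
      by (rule has_derivative_compose[OF _ D(1)]) (auto intro!: derivative_eq_intros)
    then show ?thesis
      by (simp add: has_field_derivative_def inner_axis mult_commute_abs)
  qed
  define h where "h n = 1 / real (Suc n)" for n
  have h: "0 < h n" "h n \<le> 1" for n by (auto simp: h_def)
  define s where "s n x = (g (h n *\<^sub>R ?v + x) - g x) / h n" for n x
  have int_g: "integrable lborel g"
    by (rule integrable_continuous_cball[OF D(3), of R]) (use R in blast)
  have g_meas: "g \<in> borel_measurable borel"
    using D(3) by (rule borel_measurable_continuous_onI)
  have int_shift: "(\<integral>x. g (h n *\<^sub>R ?v + x) \<partial>lborel) = (\<integral>x. g x \<partial>lborel)"
    and intble_shift: "integrable lborel (\<lambda>x. g (h n *\<^sub>R ?v + x))" for n
  proof -
    have "(\<integral>x. g x \<partial>lborel) = (\<integral>x. g x \<partial>distr lborel borel ((+) (h n *\<^sub>R ?v)))"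
      by (simp add: lborel_distr_plus)
    then show "(\<integral>x. g (h n *\<^sub>R ?v + x) \<partial>lborel) = (\<integral>x. g x \<partial>lborel)"
      by (subst (asm) integral_distr) (use g_meas in auto)
    have "integrable (distr lborel borel ((+) (h n *\<^sub>R ?v))) g"
      using int_g by (simp add: lborel_distr_plus)
    then show "integrable lborel (\<lambda>x. g (h n *\<^sub>R ?v + x))"
      by (subst (asm) integrable_distr_eq) (use g_meas in auto)
  qed
  have s0: "(\<integral>x. s n x \<partial>lborel) = 0" for n
    unfolding s_def using int_shift intble_shift int_g by simp
  have lim: "(\<lambda>n. \<integral>x. s n x \<partial>lborel) \<longlonglongrightarrow> (\<integral>x. grad g x $ i \<partial>lborel)"
  proof (rule integral_dominated_convergence)
    show "(\<lambda>x. grad g x $ i) \<in> borel_measurable lborel"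
      using D(2) by (auto intro!: borel_measurable_continuous_onI continuous_intros)
    show "s n \<in> borel_measurable lborel" for n
      unfolding s_def using g_meas by measurable
    show "integrable lborel (\<lambda>x. indicator (cball (0::real^'n) (R + 1)) x *\<^sub>R M)"
      by (rule borel_integrable_compact) auto
    show "AE x in lborel. (\<lambda>n. s n x) \<longlonglongrightarrow> grad g x $ i"
    proof (rule AE_I2)
      fix x
      have "(\<lambda>t. (g (x + (0 + t) *\<^sub>R ?v) - g (x + 0 *\<^sub>R ?v)) / t) \<midarrow>0\<rightarrow> grad g (x + 0 *\<^sub>R ?v) $ i"
        using line[of x 0] unfolding DERIV_def by simp
      moreover have "filterlim h (at 0) sequentially"
        unfolding filterlim_at h_def using LIMSEQ_inverse_real_of_nat
        by (auto simp: inverse_eq_divide)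
      ultimately have "(\<lambda>n. (g (x + (0 + h n) *\<^sub>R ?v) - g (x + 0 *\<^sub>R ?v)) / h n) \<longlonglongrightarrow> grad g x $ i"
        using filterlim_compose by force
      then show "(\<lambda>n. s n x) \<longlonglongrightarrow> grad g x $ i" by (simp add: s_def add.commute)
    qed
    show "AE x in lborel. norm (s n x) \<le> indicator (cball 0 (R + 1)) x *\<^sub>R M" for n
    proof (rule AE_I2)
      fix x
      \<comment> \<open>The mean value theorem turns the quotient into a derivative at distance less
        than \<open>h n \<le> 1\<close> from \<open>x\<close>, which explains the radius
        \<open>R + 1\<close> of the dominating function.\<close>
      obtain z where z: "0 < z" "z < h n"
        "g (x + h n *\<^sub>R ?v) - g (x + 0 *\<^sub>R ?v) = (h n - 0) * (grad g (x + z *\<^sub>R ?v) $ i)"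
        using MVT2[OF h(1)[of n], of "\<lambda>t. g (x + t *\<^sub>R ?v)" "\<lambda>t. grad g (x + t *\<^sub>R ?v) $ i"] line
        by blast
      have s: "s n x = grad g (x + z *\<^sub>R ?v) $ i"
        using z(3) h(1)[of n] by (simp add: s_def add.commute field_simps)
      show "norm (s n x) \<le> indicator (cball 0 (R + 1)) x *\<^sub>R M"
      proof (cases "grad g (x + z *\<^sub>R ?v) = 0")
        case True
        then show ?thesis using s \<open>M \<ge> 0\<close> by (simp add: indicator_def)
      next
        case False
        have "norm x \<le> norm (x + z *\<^sub>R ?v) + norm (z *\<^sub>R ?v)"
          by (metis add_diff_cancel_right' norm_triangle_ineq4)
        also have "\<dots> \<le> R + 1" using R(2)[of "x + z *\<^sub>R ?v"] False z h(2)[of n] by simp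
        finally show ?thesis using s M' by simp
      qed
    qed
  qed
  have "(\<lambda>n. \<integral>x. s n x \<partial>lborel) \<longlonglongrightarrow> 0" using s0 by simp
  with lim show ?thesis using LIMSEQ_unique by blast
qed

section \<open>Local integrability of products of powers of the coordinates\<close>

lemma nn_integral_abs_powr_finite:
  fixes c R :: real
  assumes "c < 1" "R \<ge> 0"
  shows "(\<integral>\<^sup>+t. ennreal (indicator {-R..R} t * \<bar>t\<bar> powr (-c)) \<partial>lborel) < \<infinity>"
proof -
  define f where "f t = indicator {0..R} t * t powr (-c)" for t :: real
  have fm: "f \<in> borel_measurable borel" unfolding f_def by measurable
  have f_eq: "f = (\<lambda>t. if t \<in> {0..R} then t powr (-c) else 0)"
    by (auto simp: f_def)
  have "((\<lambda>t. t powr (-c)) has_integral (R powr (-c+1) / (-c+1))) {0..R}"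
    using assms by (intro has_integral_powr_from_0) auto
  then have "(f has_integral (R powr (-c+1) / (-c+1))) UNIV"
    unfolding f_eq by (simp only: has_integral_restrict_UNIV)
  from nn_integral_has_integral_lborel[OF fm _ this]
  have 1: "(\<integral>\<^sup>+t. ennreal (f t) \<partial>lborel) = ennreal (R powr (-c+1) / (-c+1))"
    by (auto simp: f_def)
  have 2: "(\<integral>\<^sup>+t. ennreal (f (-t)) \<partial>lborel) = (\<integral>\<^sup>+t. ennreal (f t) \<partial>lborel)"
    using nn_integral_real_affine[of "\<lambda>t. ennreal (f t)" "-1" 0] fm by simp
  have "(\<integral>\<^sup>+t. ennreal (indicator {-R..R} t * \<bar>t\<bar> powr (-c)) \<partial>lborel)
      \<le> (\<integral>\<^sup>+t. ennreal (f t) + ennreal (f (-t)) \<partial>lborel)"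
    by (intro nn_integral_mono) (auto simp: f_def indicator_def abs_if)
  also have "\<dots> = (\<integral>\<^sup>+t. ennreal (f t) \<partial>lborel) + (\<integral>\<^sup>+t. ennreal (f (-t)) \<partial>lborel)"
    using fm by (intro nn_integral_add) auto
  also have "\<dots> < \<infinity>" using 1 2 by simp
  finally show ?thesis .
qed

text \<open>By Tonelli the integral over the cube of half-side \<open>R\<close> is a product of
  one-dimensional integrals, each finite because its exponent is above -1; the ball lies in the
  cube.\<close>

lemma integrable_prod_abs_powr:
  fixes c :: "'n::finite \<Rightarrow> real"
  assumes c: "\<And>i. c i < 1" and "R \<ge> 0"
  shows "integrable lborel (\<lambda>x :: real ^ 'n. indicator (cball 0 R) x * (\<Prod>i\<in>UNIV. \<bar>x $ i\<bar> powr (- c i)))"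
proof -
  \<comment> \<open>The product formula for \<open>lborel\<close> runs over \<open>Basis\<close>, so
    the coordinate index has to be recovered from the basis vector.\<close>
  define F :: "real ^ 'n \<Rightarrow> real \<Rightarrow> real" where
    "F b t = indicator {-R..R} t * \<bar>t\<bar> powr (- c (SOME i. b = axis i 1))" for b t
  have [measurable]: "(\<lambda>x :: real ^ 'n. x $ i) \<in> borel_measurable borel" for i
    by (intro borel_measurable_continuous_onI continuous_intros)
  have prod: "(\<Prod>b\<in>Basis. F b (x \<bullet> b)) = (\<Prod>i\<in>UNIV. indicator {-R..R} (x $ i) * \<bar>x $ i\<bar> powr (- c i))"
    for x :: "real ^ 'n"
  proof -
    have B: "(Basis :: (real ^ 'n) set) = (\<lambda>i. axis i 1) ` UNIV"
      by (auto simp: Basis_vec_def)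
    have inj: "inj (\<lambda>i::'n. axis i (1::real))" by (auto simp: inj_def axis_eq_axis)
    show ?thesis
      unfolding B by (subst prod.reindex[OF inj]) (simp add: F_def inner_axis axis_eq_axis)
  qed
  have meas: "F b \<in> borel_measurable borel" for b unfolding F_def by measurable
  have fin: "(\<integral>\<^sup>+t. ennreal (F b t) \<partial>lborel) < \<infinity>" for b
    unfolding F_def using c \<open>R \<ge> 0\<close> by (rule nn_integral_abs_powr_finite)
  have "(\<integral>\<^sup>+x. ennreal (\<Prod>b\<in>Basis. F b (x \<bullet> b)) \<partial>lborel) = (\<integral>\<^sup>+x. (\<Prod>b\<in>Basis. ennreal (F b ((x :: real ^ 'n) \<bullet> b))) \<partial>lborel)"
    by (intro nn_integral_cong prod_ennreal[symmetric]) (auto simp: F_def)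
  also have "\<dots> = (\<Prod>b\<in>Basis. (\<integral>\<^sup>+t. ennreal (F (b :: real ^ 'n) t) \<partial>lborel))"
    by (rule nn_integral_lborel_prod) (use meas in auto)
  also have "\<dots> < \<infinity>" using fin by (simp add: ennreal_prod_eq_top less_top[symmetric])
  finally have "integrable lborel (\<lambda>x. \<Prod>b\<in>Basis. F b ((x :: real ^ 'n) \<bullet> b))"
    using meas by (intro integrableI_nonneg) (auto simp: F_def intro!: prod_nonneg)
  then have "integrable lborel (\<lambda>x :: real ^ 'n. \<Prod>i\<in>UNIV. indicator {-R..R} (x $ i) * \<bar>x $ i\<bar> powr (- c i))"
    by (simp add: prod)
  then show ?thesis
  proof (rule Bochner_Integration.integrable_bound)
    show "AE x in lborel. norm (indicator (cball 0 R) x * (\<Prod>i\<in>UNIV. \<bar>x $ i\<bar> powr (- c i)))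
       \<le> norm (\<Prod>i\<in>UNIV. indicator {-R..R} (x $ i) * \<bar>x $ i\<bar> powr (- c i))"
    proof (rule AE_I2)
      fix x :: "real ^ 'n"
      show "norm (indicator (cball 0 R) x * (\<Prod>i\<in>UNIV. \<bar>x $ i\<bar> powr (- c i)))
       \<le> norm (\<Prod>i\<in>UNIV. indicator {-R..R} (x $ i) * \<bar>x $ i\<bar> powr (- c i))"
      proof (cases "x \<in> cball 0 R")
        case True
        then have "\<bar>x $ i\<bar> \<le> R" for i using component_le_norm_cart[of x i] by auto
        then have "indicator {-R..R} (x $ i) = (1::real)" for i
          by (auto simp: indicator_def abs_le_iff minus_le_iff)
        then show ?thesis using True by simp
      qed simp
    qed
    have [measurable]: "cball (0 :: real ^ 'n) R \<in> sets borel" by simp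
    show "(\<lambda>x. indicator (cball 0 R) x * (\<Prod>i\<in>UNIV. \<bar>x $ i\<bar> powr (- c i))) \<in> borel_measurable lborel"
      by (intro borel_measurable_times borel_measurable_indicator borel_measurable_prod) measurable
  qed
qed

text \<open>Off this null set every |X_m| is positive, so the conventional values
  \<open>x / 0 = 0\<close> and \<open>0 powr s = 0\<close> do not enter the estimates made almost
  everywhere.\<close>

lemma AE_all_components_nonzero: "AE x in lborel. \<forall>i. (x :: real ^ 'n) $ i \<noteq> 0"
proof -
  have "AE x in lborel. (x :: real ^ 'n) $ i \<noteq> 0" for i
  proof -
    have "{x :: real ^ 'n. x $ i = 0} \<in> null_sets lebesgue"
      using negligible_standard_hyperplane_cart[of i] negligible_iff_null_sets by blast
    then have "AE x in lebesgue. (x :: real ^ 'n) $ i \<noteq> 0"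
      by (rule AE_I') auto
    then show ?thesis by (simp add: AE_completion_iff)
  qed
  then show ?thesis by (simp add: AE_all_countable)
qed

lemma norm_add_scaleR_sq:
  fixes a b :: "'a::real_inner"
  shows "(norm (a + c *\<^sub>R b))\<^sup>2 = (norm a)\<^sup>2 + 2 * c * (a \<bullet> b) + c\<^sup>2 * (norm b)\<^sup>2"
  unfolding power2_norm_eq_inner
  by (simp add: inner_add inner_commute[of b a] power2_eq_square algebra_simps)

text \<open>Summation by parts in the exponents: only their partial sums matter, because \<open>R\<close> is increasing.\<close>

lemma prod_powr_abel:
  fixes R a b :: "nat \<Rightarrow> real"
  assumes "k \<ge> 3" and pos: "\<And>m. m \<ge> 3 \<Longrightarrow> R m > 0" and mono: "\<And>m. m \<ge> 3 \<Longrightarrow> R m \<le> R (Suc m)"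
    and le: "\<And>m. m \<in> {3..k} \<Longrightarrow> (\<Sum>j=3..m. b j) \<le> (\<Sum>j=3..m. a j)"
  shows "(\<Prod>m=3..k. R m powr a m) \<le>
    (\<Prod>m=3..k. R m powr b m) * R k powr ((\<Sum>j=3..k. a j) - (\<Sum>j=3..k. b j))"
  using \<open>k \<ge> 3\<close> le
proof (induction k rule: dec_induct)
  case base
  then show ?case by (simp flip: powr_add)
next
  case (step k)
  define D where "D = (\<Sum>j=3..Suc k. a j) - (\<Sum>j=3..Suc k. b j)"
  let ?A = "\<Sum>j=3..k. a j" and ?B = "\<Sum>j=3..k. b j"
  have "(\<Prod>m=3..Suc k. R m powr a m) = (\<Prod>m=3..k. R m powr a m) * R (Suc k) powr a (Suc k)"
    using step by simp
  also have "\<dots> \<le> ((\<Prod>m=3..k. R m powr b m) * R k powr (?A - ?B)) * R (Suc k) powr a (Suc k)"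
    using step by (intro mult_right_mono step.IH) auto
  also have "\<dots> \<le> ((\<Prod>m=3..k. R m powr b m) * R (Suc k) powr (?A - ?B)) * R (Suc k) powr a (Suc k)"
    using step pos[of k] mono[of k] by (intro mult_right_mono mult_left_mono powr_mono2 prod_nonneg) (auto simp: less_imp_le)
  also have "\<dots> = (\<Prod>m=3..k. R m powr b m) * R (Suc k) powr (?A - ?B + a (Suc k))"
    by (simp add: powr_add)
  also have "\<dots> = (\<Prod>m=3..k. R m powr b m) * R (Suc k) powr (b (Suc k) + D)"
  proof -
    have "?A - ?B + a (Suc k) = b (Suc k) + D" using step(1) by (simp add: D_def)
    then show ?thesis by simp
  qed
  also have "\<dots> = (\<Prod>m=3..Suc k. R m powr b m) * R (Suc k) powr D"
    using step(1) by (simp add: powr_add)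
  finally show ?case unfolding D_def .
qed

section \<open>A flat function as the source of bump functions\<close>

text \<open>The functions exp(-1/t) t^(-j), extended by 0. The index \<open>j\<close> makes the
  family closed under differentiation up to linear combinations, so smoothness follows without a
  formula for higher derivatives.\<close>

definition flat :: "nat \<Rightarrow> real \<Rightarrow> real" where
  "flat j t = (if t > 0 then exp (- (1 / t)) * (1 / t) ^ j else 0)"

lemma flat_pos: "t > 0 \<Longrightarrow> flat j t > 0"
  by (simp add: flat_def)

lemma flat_nonneg: "flat j t \<ge> 0"
  by (simp add: flat_def)

lemma DERIV_flat: "(flat j has_real_derivative flat (j + 2) t - real j * flat (j + 1) t) (at t)"
proof -
  consider "t > 0" | "t < 0" | "t = 0" by linarith
  then show ?thesis
  proof cases
    case 1
    have "((\<lambda>t. exp (- (1 / t)) * (1 / t) ^ j) has_real_derivative flat (j + 2) t - real j * flat (j + 1) t) (at t)"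
    proof -
      have "((\<lambda>s. exp (- s) * s ^ j) has_real_derivative
          - exp (- (1 / t)) * (1 / t) ^ j + exp (- (1 / t)) * (real j * (1 / t) ^ (j - 1))) (at (1 / t))"
        by (auto intro!: derivative_eq_intros)
      moreover have "((\<lambda>t. 1 / t) has_real_derivative - ((1 / t) * (1 / t))) (at t)"
        using 1 by (auto intro!: derivative_eq_intros)
      ultimately have "((\<lambda>t. exp (- (1 / t)) * (1 / t) ^ j) has_real_derivative
          (- exp (- (1 / t)) * (1 / t) ^ j + exp (- (1 / t)) * (real j * (1 / t) ^ (j - 1)))
            * - ((1 / t) * (1 / t))) (at t)"
        by (rule DERIV_chain2)
      also have "(- exp (- (1 / t)) * (1 / t) ^ j + exp (- (1 / t)) * (real j * (1 / t) ^ (j - 1)))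
            * - ((1 / t) * (1 / t)) = flat (j + 2) t - real j * flat (j + 1) t"
        using 1 by (cases j) (simp_all add: flat_def add_divide_distrib algebra_simps)
      finally show ?thesis .
    qed
    then show ?thesis
      by (rule has_field_derivative_transform_within_open[where S = "{0<..}"]) (use 1 in \<open>auto simp: flat_def\<close>)
  next
    case 2
    have "((\<lambda>_. 0) has_real_derivative flat (j + 2) t - real j * flat (j + 1) t) (at t)"
      using 2 by (simp add: flat_def)
    then show ?thesis
      by (rule has_field_derivative_transform_within_open[where S = "{..<0}"]) (use 2 in \<open>auto simp: flat_def\<close>)
  next
    case 3
    \<comment> \<open>With s = 1/h the quotient from the right is s^(j+1)/exp s, which tends to 0 as
      s grows; from the left it is 0.\<close>
    have "((\<lambda>h. flat j h / h) \<longlongrightarrow> 0) (at 0)"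
    proof (rule filterlim_split_at)
      show "((\<lambda>h. flat j h / h) \<longlongrightarrow> 0) (at_left 0)"
        by (rule tendsto_eventually) (auto simp: eventually_at_filter flat_def)
      have "((\<lambda>h::real. inverse h ^ Suc j / exp (inverse h)) \<longlongrightarrow> 0) (at_right 0)"
        using tendsto_power_div_exp_0 filterlim_inverse_at_top_right by (rule filterlim_compose)
      then show "((\<lambda>h. flat j h / h) \<longlongrightarrow> 0) (at_right 0)"
        by (rule Lim_transform_eventually)
           (auto simp: eventually_at_filter flat_def exp_minus field_simps)
    qed
    then show ?thesis using 3 by (simp add: DERIV_def flat_def)
  qed
qed

lemma continuous_on_flat [continuous_intros]:
  "continuous_on S f \<Longrightarrow> continuous_on S (\<lambda>x. flat j (f x))"
  by (rule continuous_on_compose2[of UNIV "flat j"])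
     (auto intro!: DERIV_continuous_on[OF has_field_derivative_at_within[OF DERIV_flat]])

text \<open>\<open>y powr s\<close> is \<open>exp (s * ln y)\<close>, and
  \<open>\<bar>s * ln y\<bar> \<le> S * ln D\<close>. Both signs of \<open>s\<close> are covered,
  since the exponents of the ground state have no fixed sign.\<close>

lemma powr_lower_bound:
  fixes y D s S :: real
  assumes "1 \<le> D" "1 / D \<le> y" "y \<le> D" "\<bar>s\<bar> \<le> S"
  shows "D powr (- S) \<le> y powr s"
proof -
  have "0 < 1 / D" using assms by simp
  then have "0 < y" using assms by linarith
  have "D powr (- S) \<le> D powr (- \<bar>s\<bar>)" using assms by (intro powr_mono) auto
  also have "\<dots> \<le> y powr s"
  proof (cases "s \<ge> 0")
    case True
    have "D powr (- \<bar>s\<bar>) = (1 / D) powr s" using True assms by (simp add: powr_minus_divide powr_divide)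
    also have "\<dots> \<le> y powr s" using True assms by (intro powr_mono2) auto
    finally show ?thesis .
  next
    case False
    then show ?thesis using assms \<open>0 < y\<close> by (auto intro: powr_mono2')
  qed
  finally show ?thesis .
qed

text \<open>The candidate for \<open>\<alpha>\<close> in the converse direction, started at \<open>\<alpha> 2 = 0\<close> so that \<open>\<beta> 3\<close> need
  not be treated separately. The parameter \<open>\<tau>\<close> makes the values strictly negative.\<close>

fun alpha_of :: "(nat \<Rightarrow> real) \<Rightarrow> real \<Rightarrow> nat \<Rightarrow> real" where
  "alpha_of \<beta> \<tau> m = (if m \<le> 2 then 0 else - sqrt ((alpha_of \<beta> \<tau> (m - 1) - 1 / 2)\<^sup>2 - \<beta> m + \<tau>))"

declare alpha_of.simps [simp del]

lemma alpha_of_2 [simp]: "alpha_of \<beta> \<tau> 2 = 0"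
  by (simp add: alpha_of.simps)

lemma alpha_of_rec:
  "3 \<le> m \<Longrightarrow> alpha_of \<beta> \<tau> m = - sqrt ((alpha_of \<beta> \<tau> (m - 1) - 1 / 2)\<^sup>2 - \<beta> m + \<tau>)"
  by (subst alpha_of.simps) simp

text \<open>Allows \<tau> -> 0 in \<open>hardy_necessary\<close>. Here \<open>sqrt\<close> is the
  odd extension to the whole line and continuous there, so the sign of the radicand does not matter
  for continuity.\<close>

lemma continuous_on_alpha_of: "continuous_on UNIV (\<lambda>\<tau>. alpha_of \<beta> \<tau> m)"
proof (induction m)
  case 0
  then show ?case by (simp add: alpha_of.simps)
next
  case (Suc m)
  show ?case
  proof (cases "Suc m \<le> 2")
    case True
    then show ?thesis by (simp add: alpha_of.simps)
  next
    case False
    then have "(\<lambda>\<tau>. alpha_of \<beta> \<tau> (Suc m)) =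
        (\<lambda>\<tau>. - sqrt ((alpha_of \<beta> \<tau> m - 1 / 2)\<^sup>2 - \<beta> (Suc m) + \<tau>))"
      using alpha_of_rec[of "Suc m"] by auto
    then show ?thesis using Suc by (simp only:) (intro continuous_intros)
  qed
qed

section \<open>The ground state identity\<close>

locale coords =
  fixes n :: nat and e :: "nat \<Rightarrow> 'n::finite"
  assumes e: "bij_betw e {1..n} UNIV" and n: "3 \<le> n"
begin

section \<open>Nested coordinate projections\<close>

abbreviation P :: "nat \<Rightarrow> real ^ 'n \<Rightarrow> real ^ 'n" where
  "P \<equiv> proj_first e"

lemma proj_nth: "P m x $ i = (if i \<in> e ` {1..m} then x $ i else 0)"
  by (simp add: proj_first_def)

lemma inner_proj_proj:
  assumes "m \<le> l"
  shows "P m x \<bullet> P l y = P m x \<bullet> y"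
proof -
  have "e ` {1..m} \<subseteq> e ` {1..l}" using assms by auto
  then show ?thesis
    unfolding inner_vec_def by (intro sum.cong) (auto simp: proj_nth)
qed

text \<open>The nesting of the projections makes the cross terms in \<open>ground_pot_0\<close>
  collapse to a sum of exponents.\<close>

lemma inner_proj_self: "m \<le> l \<Longrightarrow> P m x \<bullet> P l x = (norm (P m x))\<^sup>2"
  using inner_proj_proj[of m l x x] inner_proj_proj[of m m x x]
  by (simp add: power2_norm_eq_inner)

lemma norm_proj_sq: "(norm (P m x))\<^sup>2 = (\<Sum>i\<in>e ` {1..m}. (x $ i)\<^sup>2)"
proof -
  have "(norm (P m x))\<^sup>2 = (\<Sum>i\<in>UNIV. if i \<in> e ` {1..m} then (x $ i)\<^sup>2 else 0)"
    unfolding power2_norm_eq_inner inner_vec_def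
    by (intro sum.cong) (auto simp: proj_nth power2_eq_square)
  then show ?thesis by (simp add: sum.If_cases)
qed

lemma norm_proj_mono:
  assumes "m \<le> l"
  shows "norm (P m x) \<le> norm (P l x)"
proof -
  have "(norm (P m x))\<^sup>2 \<le> (norm (P l x))\<^sup>2"
    unfolding norm_proj_sq using assms by (intro sum_mono2) auto
  then show ?thesis by (rule power2_le_imp_le) simp
qed

lemma abs_nth_le_norm_proj: "i \<in> e ` {1..m} \<Longrightarrow> \<bar>x $ i\<bar> \<le> norm (P m x)"
  using component_le_norm_cart[of "P m x" i] by (auto simp: proj_nth)

lemma linear_proj: "linear (P m)"
  by (rule linearI) (auto simp: vec_eq_iff proj_nth)

lemma bounded_linear_proj: "bounded_linear (P m)"
  using linear_proj by (simp add: linear_linear)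

lemma has_derivative_proj [derivative_intros]:
  assumes "(f has_derivative f') F"
  shows "((\<lambda>x. P m (f x)) has_derivative (\<lambda>h. P m (f' h))) F"
  by (rule bounded_linear.has_derivative[OF bounded_linear_proj assms])

lemma continuous_on_proj [continuous_intros]:
  "continuous_on S f \<Longrightarrow> continuous_on S (\<lambda>x. P m (f x))"
  by (rule bounded_linear.continuous_on[OF bounded_linear_proj])

definition rsq :: "real \<Rightarrow> nat \<Rightarrow> real ^ 'n \<Rightarrow> real" where
  "rsq \<epsilon> m x = (norm (P m x))\<^sup>2 + \<epsilon>"

lemma rsq_pos: "\<epsilon> > 0 \<Longrightarrow> rsq \<epsilon> m x > 0"
  by (simp add: rsq_def add_nonneg_pos)

lemma rsq_neq_0: "\<epsilon> > 0 \<Longrightarrow> rsq \<epsilon> m x \<noteq> 0"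
  using rsq_pos less_irrefl by metis

lemma has_derivative_rsq:
  "(rsq \<epsilon> m has_derivative (\<lambda>h. 2 * (P m x \<bullet> h))) (at x)"
proof -
  have "P m x \<bullet> P m h = P m x \<bullet> h" "P m h \<bullet> P m x = P m x \<bullet> h" for h
    using inner_proj_proj[of m m x h] by (simp_all add: inner_commute)
  then show ?thesis
    unfolding rsq_def power2_norm_eq_inner by (auto intro!: derivative_eq_intros)
qed

lemma continuous_on_rsq [continuous_intros]:
  "continuous_on S f \<Longrightarrow> continuous_on S (\<lambda>x. rsq \<epsilon> m (f x))"
  unfolding rsq_def by (intro continuous_intros)

text \<open>\<open>f\<close> is the divergence of the compactly supported C^1 field
  \<open>((u x)\<^sup>2 / rsq \<epsilon> m x) *\<^sub>R P m x\<close>, and each term of a divergence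
  integrates to 0. The summand with \<open>real m\<close> is the divergence of
  \<open>P m\<close>.\<close>

lemma integral_parts_radial:
  fixes u :: "real ^ 'n \<Rightarrow> real"
  assumes "C1c u" "\<epsilon> > 0" "m \<le> n"
  defines "f \<equiv> \<lambda>x. 2 * u x * (grad u x \<bullet> P m x) / rsq \<epsilon> m x
      + (u x)\<^sup>2 * (real m / rsq \<epsilon> m x - 2 * (norm (P m x))\<^sup>2 / (rsq \<epsilon> m x)\<^sup>2)"
  shows "integrable lborel f" "(\<integral>x. f x \<partial>lborel) = 0"
proof -
  note D = C1cD[OF assms(1)]
  have R0: "rsq \<epsilon> m x \<noteq> 0" for x using rsq_neq_0 \<open>\<epsilon> > 0\<close> by simp
  obtain B where B: "\<And>x. u x \<noteq> 0 \<or> grad u x \<noteq> 0 \<Longrightarrow> x \<in> cball 0 B"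
    using D(4) by blast
  define g where "g i x = (u x)\<^sup>2 * (P m x $ i) / rsq \<epsilon> m x" for i x
  \<comment> \<open>\<open>v i\<close> represents the functional \<open>P m x $ i\<close>, so that
    the product and quotient rules act on plain inner products.\<close>
  define v :: "'n \<Rightarrow> real ^ 'n" where "v i = (if i \<in> e ` {1..m} then axis i 1 else 0)" for i
  define G where "G i x = (2 * u x * (P m x $ i) / rsq \<epsilon> m x) *\<^sub>R grad u x
     + ((u x)\<^sup>2 / rsq \<epsilon> m x) *\<^sub>R v i
     - (2 * (u x)\<^sup>2 * (P m x $ i) / (rsq \<epsilon> m x)\<^sup>2) *\<^sub>R P m x" for i x
  have v: "P m h $ i = v i \<bullet> h" for i h
    by (simp add: proj_nth v_def inner_axis')
  have g_eq: "g i = (\<lambda>x. (u x)\<^sup>2 * (v i \<bullet> x) / rsq \<epsilon> m x)" for i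
    by (simp add: fun_eq_iff g_def v)
  have G: "C1c (g i)" "grad (g i) = G i" for i
  proof -
    have der: "(g i has_derivative (\<lambda>h. G i x \<bullet> h)) (at x)" for x
    proof -
      have "((\<lambda>x. (u x)\<^sup>2 * (v i \<bullet> x)) has_derivative
          (\<lambda>h. 2 * u x * (grad u x \<bullet> h) * (v i \<bullet> x) + (u x)\<^sup>2 * (v i \<bullet> h))) (at x)"
        by (auto intro!: derivative_eq_intros D(1))
      from has_derivative_divide'[OF this has_derivative_rsq R0]
      have "(g i has_derivative (\<lambda>h. ((2 * u x * (grad u x \<bullet> h) * (v i \<bullet> x) + (u x)\<^sup>2 * (v i \<bullet> h)) * rsq \<epsilon> m x
          - (u x)\<^sup>2 * (v i \<bullet> x) * (2 * (P m x \<bullet> h))) / (rsq \<epsilon> m x * rsq \<epsilon> m x))) (at x)"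
        by (simp only: g_eq)
      moreover have "((2 * U * A * p + U\<^sup>2 * b) * r - U\<^sup>2 * p * (2 * c)) / (r * r)
          = 2 * U * p / r * A + U\<^sup>2 / r * b - 2 * U\<^sup>2 * p / r\<^sup>2 * c" if "r \<noteq> 0" for U A p b r c :: real
        using that by (simp add: field_simps power2_eq_square)
      ultimately show ?thesis
        unfolding G_def v inner_simps using R0[of x] by simp
    qed
    have cont: "continuous_on UNIV (G i)"
      unfolding G_def by (intro continuous_intros D(2,3)) (use R0 in auto)
    have "{x. g i x \<noteq> 0} \<subseteq> cball 0 B" using B by (auto simp: g_def)
    then have bd: "bounded {x. g i x \<noteq> 0}" by (rule bounded_subset[rotated]) simp
    show "C1c (g i)" "grad (g i) = G i" using C1cI[OF der cont bd] by auto
  qed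
  have int: "integrable lborel (\<lambda>x. G i x $ i)" for i
  proof (rule integrable_continuous_cball[of _ B])
    show "continuous_on UNIV (\<lambda>x. G i x $ i)"
      using C1cD(2)[OF G(1)] unfolding G(2) by (intro continuous_intros)
    show "x \<in> cball 0 B" if "G i x $ i \<noteq> 0" for x
    proof (rule B)
      show "u x \<noteq> 0 \<or> grad u x \<noteq> 0" using that by (auto simp: G_def)
    qed
  qed
  have zero: "(\<integral>x. G i x $ i \<partial>lborel) = 0" for i
    using integral_partial_eq_0[OF G(1)] unfolding G(2) by blast
  have f: "f x = (\<Sum>i\<in>UNIV. G i x $ i)" for x
  proof -
    have "inj_on e {1..m}"
      using e assms(3) by (auto simp: bij_betw_def intro: inj_on_subset)
    \<comment> \<open>The trace of the projection. It equals \<open>m\<close> because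
      \<open>e\<close> lists \<open>m\<close> distinct coordinates when
      \<open>m \<le> n\<close>.\<close>
    then have card: "(\<Sum>i\<in>UNIV. v i $ i) = real m"
    proof -
      have "(\<Sum>i\<in>UNIV. v i $ i) = (\<Sum>i\<in>UNIV. if i \<in> e ` {1..m} then 1 else 0)"
        by (intro sum.cong) (auto simp: v_def)
      then show ?thesis using \<open>inj_on e {1..m}\<close> by (simp add: sum.If_cases card_image)
    qed
    have "(\<Sum>i\<in>UNIV. G i x $ i) =
        2 * u x / rsq \<epsilon> m x * (\<Sum>i\<in>UNIV. grad u x $ i * P m x $ i)
      + (u x)\<^sup>2 / rsq \<epsilon> m x * (\<Sum>i\<in>UNIV. v i $ i)
      - 2 * (u x)\<^sup>2 / (rsq \<epsilon> m x)\<^sup>2 * (\<Sum>i\<in>UNIV. P m x $ i * P m x $ i)"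
      unfolding G_def by (simp add: sum_distrib_left sum.distrib sum_subtractf mult_ac sum_divide_distrib)
    also have "\<dots> = f x"
      unfolding card f_def by (simp add: power2_norm_eq_inner inner_vec_def algebra_simps)
    finally show ?thesis by simp
  qed
  show "integrable lborel f" "(\<integral>x. f x \<partial>lborel) = 0"
    unfolding f using int zero by simp_all
qed

text \<open>\<open>\<nabla>\<phi>/\<phi>\<close> and \<open>- \<Delta>\<phi>/\<phi>\<close> for the regularised ground state \<open>\<phi> = phi a k \<epsilon>\<close> defined below. For \<open>\<epsilon> = 0\<close>
  both take junk values where \<open>P 3 x = 0\<close>.\<close>

definition log_grad :: "(nat \<Rightarrow> real) \<Rightarrow> nat \<Rightarrow> real \<Rightarrow> real ^ 'n \<Rightarrow> real ^ 'n" where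
  "log_grad a k \<epsilon> x = (\<Sum>m=3..k. (a m / rsq \<epsilon> m x) *\<^sub>R P m x)"

definition ground_pot :: "(nat \<Rightarrow> real) \<Rightarrow> nat \<Rightarrow> real \<Rightarrow> real ^ 'n \<Rightarrow> real" where
  "ground_pot a k \<epsilon> x = - (\<Sum>m=3..k. a m * (real m / rsq \<epsilon> m x - 2 * (norm (P m x))\<^sup>2 / (rsq \<epsilon> m x)\<^sup>2))
     - (norm (log_grad a k \<epsilon> x))\<^sup>2"

lemma continuous_on_log_grad: "\<epsilon> > 0 \<Longrightarrow> continuous_on UNIV (log_grad a k \<epsilon>)"
  unfolding log_grad_def by (intro continuous_intros) (auto simp: rsq_neq_0)

lemma continuous_on_ground_pot: "\<epsilon> > 0 \<Longrightarrow> continuous_on UNIV (ground_pot a k \<epsilon>)"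
  unfolding ground_pot_def by (intro continuous_intros continuous_on_log_grad) (auto simp: rsq_neq_0)

text \<open>With H = \<open>log_grad a k \<epsilon>\<close>, \<open>ground_pot\<close> is - div H -
  |H|^2. Expanding |grad u - u H|^2 shows that the two sides differ by the integral of div (u^2 H),
  a combination of the divergences in \<open>integral_parts_radial\<close>.\<close>

lemma ground_state_identity:
  fixes u :: "real ^ 'n \<Rightarrow> real"
  assumes "C1c u" "\<epsilon> > 0" "k \<le> n"
  shows "integrable lborel (\<lambda>x. (norm (grad u x))\<^sup>2)"
    and "integrable lborel (\<lambda>x. (norm (grad u x - u x *\<^sub>R log_grad a k \<epsilon> x))\<^sup>2)"
    and "integrable lborel (\<lambda>x. ground_pot a k \<epsilon> x * (u x)\<^sup>2)"
    and "(\<integral>x. (norm (grad u x))\<^sup>2 \<partial>lborel) =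
      (\<integral>x. (norm (grad u x - u x *\<^sub>R log_grad a k \<epsilon> x))\<^sup>2 \<partial>lborel) + (\<integral>x. ground_pot a k \<epsilon> x * (u x)\<^sup>2 \<partial>lborel)"
proof -
  note D = C1cD[OF assms(1)]
  obtain B where B: "\<And>x. u x \<noteq> 0 \<or> grad u x \<noteq> 0 \<Longrightarrow> x \<in> cball 0 B"
    using D(4) by blast
  show 1: "integrable lborel (\<lambda>x. (norm (grad u x))\<^sup>2)"
    using B by (intro integrable_continuous_cball[of _ B] continuous_intros D(2)) auto
  show 2: "integrable lborel (\<lambda>x. (norm (grad u x - u x *\<^sub>R log_grad a k \<epsilon> x))\<^sup>2)"
  proof (intro integrable_continuous_cball[of _ B] continuous_intros D continuous_on_log_grad assms)
    fix x assume "(norm (grad u x - u x *\<^sub>R log_grad a k \<epsilon> x))\<^sup>2 \<noteq> 0"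
    then have "u x \<noteq> 0 \<or> grad u x \<noteq> 0" by auto
    then show "x \<in> cball 0 B" by (rule B)
  qed
  show 3: "integrable lborel (\<lambda>x. ground_pot a k \<epsilon> x * (u x)\<^sup>2)"
  proof (intro integrable_continuous_cball[of _ B] continuous_intros D continuous_on_ground_pot assms)
    fix x assume "ground_pot a k \<epsilon> x * (u x)\<^sup>2 \<noteq> 0"
    then show "x \<in> cball 0 B" by (intro B) auto
  qed
  define f where "f m x = 2 * u x * (grad u x \<bullet> P m x) / rsq \<epsilon> m x
      + (u x)\<^sup>2 * (real m / rsq \<epsilon> m x - 2 * (norm (P m x))\<^sup>2 / (rsq \<epsilon> m x)\<^sup>2)" for m x
  have f: "integrable lborel (f m)" "(\<integral>x. f m x \<partial>lborel) = 0" if "m \<in> {3..k}" for m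
    using integral_parts_radial[OF assms(1,2), of m] that assms(3) unfolding f_def by auto
  have "(norm (grad u x))\<^sup>2 = (norm (grad u x - u x *\<^sub>R log_grad a k \<epsilon> x))\<^sup>2 + ground_pot a k \<epsilon> x * (u x)\<^sup>2
      + (\<Sum>m=3..k. a m * f m x)" for x
  proof -
    have "(\<Sum>m=3..k. a m * f m x) = 2 * u x * (grad u x \<bullet> log_grad a k \<epsilon> x)
      + (u x)\<^sup>2 * (\<Sum>m=3..k. a m * (real m / rsq \<epsilon> m x - 2 * (norm (P m x))\<^sup>2 / (rsq \<epsilon> m x)\<^sup>2))"
      unfolding f_def log_grad_def inner_sum_right sum_distrib_left sum.distrib[symmetric]
      by (intro sum.cong refl) (simp add: algebra_simps)
    moreover have "(norm (grad u x - u x *\<^sub>R log_grad a k \<epsilon> x))\<^sup>2 =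
      (norm (grad u x))\<^sup>2 - 2 * u x * (grad u x \<bullet> log_grad a k \<epsilon> x) + (u x)\<^sup>2 * (norm (log_grad a k \<epsilon> x))\<^sup>2"
      unfolding power2_norm_eq_inner by (simp add: inner_simps inner_commute power2_eq_square algebra_simps)
    ultimately show ?thesis by (simp add: ground_pot_def algebra_simps)
  qed
  then have "(\<integral>x. (norm (grad u x))\<^sup>2 \<partial>lborel) =
      (\<integral>x. (norm (grad u x - u x *\<^sub>R log_grad a k \<epsilon> x))\<^sup>2 + ground_pot a k \<epsilon> x * (u x)\<^sup>2
      + (\<Sum>m=3..k. a m * f m x) \<partial>lborel)"
    by simp
  also have "\<dots> = (\<integral>x. (norm (grad u x - u x *\<^sub>R log_grad a k \<epsilon> x))\<^sup>2 \<partial>lborel)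
      + (\<integral>x. ground_pot a k \<epsilon> x * (u x)\<^sup>2 \<partial>lborel)"
  proof -
    have "integrable lborel (\<lambda>x. \<Sum>m=3..k. a m * f m x)" "(\<integral>x. (\<Sum>m=3..k. a m * f m x) \<partial>lborel) = 0"
      using f by (auto simp: Bochner_Integration.integral_sum)
    then show ?thesis using 2 3 by simp
  qed
  finally show "(\<integral>x. (norm (grad u x))\<^sup>2 \<partial>lborel) =
      (\<integral>x. (norm (grad u x - u x *\<^sub>R log_grad a k \<epsilon> x))\<^sup>2 \<partial>lborel) + (\<integral>x. ground_pot a k \<epsilon> x * (u x)\<^sup>2 \<partial>lborel)" .
qed

section \<open>The potential in the limit \<epsilon> = 0\<close>

lemma ground_pot_tendsto:
  assumes "norm (P 3 x) > 0"
  shows "(\<lambda>N. ground_pot a k (inverse (real (Suc N))) x) \<longlonglongrightarrow> ground_pot a k 0 x"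
proof -
  have "norm (P m x) > 0" if "m \<ge> 3" for m
    using assms norm_proj_mono[OF that, of x] by linarith
  then have nz: "rsq 0 m x \<noteq> 0" if "m \<in> {3..k}" for m
    using that by (fastforce simp: rsq_def)
  have lim: "(\<lambda>N. rsq (inverse (real (Suc N))) m x) \<longlonglongrightarrow> rsq 0 m x" for m
    unfolding rsq_def by (intro tendsto_intros LIMSEQ_inverse_real_of_nat)
  show ?thesis
    unfolding ground_pot_def log_grad_def by (intro tendsto_intros lim) (use nz in auto)
qed

text \<open>All |X_m| with m >= 3 are at least |X_3|, so every term is of order 1/|X_3|^2. The
  constant is free of \<epsilon>, as dominated convergence requires.\<close>

lemma ground_pot_bound:
  assumes "norm (P 3 x) > 0" "\<epsilon> \<ge> 0"
  shows "\<bar>ground_pot a k \<epsilon> x\<bar> \<le> ((\<Sum>m=3..k. \<bar>a m\<bar> * (real m + 2)) + (\<Sum>m=3..k. \<bar>a m\<bar>)\<^sup>2) / (norm (P 3 x))\<^sup>2"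
proof -
  let ?r = "norm (P 3 x)"
  have le: "?r \<le> norm (P m x)" if "m \<in> {3..k}" for m
    using norm_proj_mono that by auto
  have le2: "?r\<^sup>2 \<le> rsq \<epsilon> m x" "(norm (P m x))\<^sup>2 \<le> rsq \<epsilon> m x" "0 < rsq \<epsilon> m x" if "m \<in> {3..k}" for m
  proof -
    have "?r\<^sup>2 \<le> (norm (P m x))\<^sup>2" using le[OF that] by (intro power_mono) auto
    moreover have "0 < ?r\<^sup>2" using assms(1) by simp
    ultimately show "?r\<^sup>2 \<le> rsq \<epsilon> m x" "(norm (P m x))\<^sup>2 \<le> rsq \<epsilon> m x" "0 < rsq \<epsilon> m x"
      using assms(2) unfolding rsq_def by linarith+
  qed
  let ?S = "\<Sum>m=3..k. a m * (real m / rsq \<epsilon> m x - 2 * (norm (P m x))\<^sup>2 / (rsq \<epsilon> m x)\<^sup>2)"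
  have "\<bar>\<Sum>m=3..k. a m * (real m / rsq \<epsilon> m x - 2 * (norm (P m x))\<^sup>2 / (rsq \<epsilon> m x)\<^sup>2)\<bar>
      \<le> (\<Sum>m=3..k. \<bar>a m\<bar> * ((real m + 2) / ?r\<^sup>2))"
  proof (rule order_trans[OF sum_abs sum_mono])
    fix m assume m: "m \<in> {3..k}"
    note l = le2[OF m]
    have "(norm (P m x))\<^sup>2 / (rsq \<epsilon> m x)\<^sup>2 \<le> rsq \<epsilon> m x / (rsq \<epsilon> m x)\<^sup>2"
      using l by (intro divide_right_mono) auto
    then have "2 * (norm (P m x))\<^sup>2 / (rsq \<epsilon> m x)\<^sup>2 \<le> 2 / rsq \<epsilon> m x"
      using l(3) by (simp add: power2_eq_square)
    moreover have "0 \<le> 2 * (norm (P m x))\<^sup>2 / (rsq \<epsilon> m x)\<^sup>2" "0 \<le> real m / rsq \<epsilon> m x"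
      "0 \<le> 2 / rsq \<epsilon> m x"
      using l(3) by auto
    ultimately have "\<bar>real m / rsq \<epsilon> m x - 2 * (norm (P m x))\<^sup>2 / (rsq \<epsilon> m x)\<^sup>2\<bar> \<le> real m / rsq \<epsilon> m x + 2 / rsq \<epsilon> m x"
      by linarith
    also have "\<dots> = (real m + 2) / rsq \<epsilon> m x" by (simp add: add_divide_distrib)
    also have "\<dots> \<le> (real m + 2) / ?r\<^sup>2"
      using l assms by (intro divide_left_mono) auto
    finally show "\<bar>a m * (real m / rsq \<epsilon> m x - 2 * (norm (P m x))\<^sup>2 / (rsq \<epsilon> m x)\<^sup>2)\<bar> \<le> \<bar>a m\<bar> * ((real m + 2) / ?r\<^sup>2)"
      by (simp only: abs_mult mult_left_mono abs_ge_zero)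
  qed
  then have S: "\<bar>?S\<bar> \<le> (\<Sum>m=3..k. \<bar>a m\<bar> * (real m + 2)) / ?r\<^sup>2"
    by (simp add: sum_divide_distrib)
  have "norm (log_grad a k \<epsilon> x) \<le> (\<Sum>m=3..k. \<bar>a m\<bar> / ?r)"
    unfolding log_grad_def
  proof (rule order_trans[OF norm_sum sum_mono])
    fix m assume m: "m \<in> {3..k}"
    note l = le2[OF m] le[OF m]
    have "norm (P m x) / rsq \<epsilon> m x \<le> norm (P m x) / (norm (P m x))\<^sup>2"
      using l assms by (intro divide_left_mono mult_pos_pos) auto
    also have "\<dots> = 1 / norm (P m x)" by (simp add: power2_eq_square)
    finally have 1: "norm (P m x) / rsq \<epsilon> m x \<le> 1 / norm (P m x)" .
    have "0 < norm (P m x)" using l(4) assms(1) by linarith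
    then have "1 / norm (P m x) \<le> 1 / ?r"
      using l(4) assms(1) by (intro divide_left_mono mult_pos_pos)  auto
    with 1 have "norm (P m x) / rsq \<epsilon> m x \<le> 1 / ?r" by linarith
    then have "\<bar>a m\<bar> * (norm (P m x) / rsq \<epsilon> m x) \<le> \<bar>a m\<bar> * (1 / ?r)"
      by (rule mult_left_mono) simp
    then show "norm ((a m / rsq \<epsilon> m x) *\<^sub>R P m x) \<le> \<bar>a m\<bar> / ?r"
      using l by simp
  qed
  then have H: "(norm (log_grad a k \<epsilon> x))\<^sup>2 \<le> ((\<Sum>m=3..k. \<bar>a m\<bar>) / ?r)\<^sup>2"
    unfolding sum_divide_distrib by (intro power_mono) auto
  have "\<bar>ground_pot a k \<epsilon> x\<bar> \<le> \<bar>?S\<bar> + (norm (log_grad a k \<epsilon> x))\<^sup>2"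
    unfolding ground_pot_def using abs_triangle_ineq4[of "- ?S" "(norm (log_grad a k \<epsilon> x))\<^sup>2"] by simp
  then show ?thesis
    using S H unfolding add_divide_distrib power_divide by linarith
qed

text \<open>The sum telescopes from \<open>\<alpha> 2 = 0\<close>. It shows that
  \<open>- \<alpha> k\<close> is the distance of the transversal degree of \<phi> from the critical
  value \<open>- (k - 2) / 2\<close>.\<close>

lemma sum_exponents:
  fixes a \<alpha> :: "nat \<Rightarrow> real"
  assumes "\<alpha> 2 = 0" "2 \<le> k" and a: "\<And>m. m \<ge> 3 \<Longrightarrow> a m = \<alpha> (m - 1) - \<alpha> m - 1 / 2"
  shows "(\<Sum>m=3..k. a m) = - \<alpha> k - (real k - 2) / 2"
  using \<open>2 \<le> k\<close>
proof (induction k rule: dec_induct)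
  case base
  then show ?case using assms by simp
next
  case (step j)
  then have "(\<Sum>m=3..Suc j. a m) = (\<Sum>m=3..j. a m) + a (Suc j)" by simp
  then show ?case using step a[of "Suc j"] by (simp add: field_simps)
qed

text \<open>Adding the factor with exponent b = \<open>a (k + 1)\<close> changes the potential by -b
  (b + 1 - 2 \<open>\<alpha> k\<close>)/|X_(k+1)|^2. With b =
  \<open>\<alpha> k - \<alpha> (k + 1) - 1 / 2\<close> this is a difference of two squares, which is
  where the formula for \<open>a\<close> comes from. The induction starts at the empty product,
  \<open>k = 2\<close>.\<close>

lemma ground_pot_0:
  assumes "norm (P 3 x) > 0" "\<alpha> 2 = 0" "k \<ge> 2"
    and a: "\<And>m. m \<ge> 3 \<Longrightarrow> a m = \<alpha> (m - 1) - \<alpha> m - 1 / 2"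
  shows "ground_pot a k 0 x = (\<Sum>m=3..k. ((\<alpha> (m - 1) - 1 / 2)\<^sup>2 - (\<alpha> m)\<^sup>2) / (norm (P m x))\<^sup>2)"
  using \<open>k \<ge> 2\<close>
proof (induction k rule: dec_induct)
  case base
  then show ?case by (simp add: ground_pot_def log_grad_def)
next
  case (step k)
  let ?r = "norm (P (Suc k) x)" and ?b = "a (Suc k)"
  have pos: "norm (P m x) > 0" if "m \<ge> 3" for m
    using assms norm_proj_mono[OF that, of x] by linarith
  have sum_a: "(\<Sum>m=3..k. a m) = - \<alpha> k - (real k - 2) / 2"
    using \<open>\<alpha> 2 = 0\<close> \<open>2 \<le> k\<close> a by (rule sum_exponents)
  have ins: "{3..Suc k} = insert (Suc k) {3..k}" using step by auto
  have r: "?r > 0" using pos step by simp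
  have H: "log_grad a (Suc k) 0 x = log_grad a k 0 x + (?b / ?r\<^sup>2) *\<^sub>R P (Suc k) x"
    unfolding log_grad_def ins by (simp add: rsq_def add.commute)
  \<comment> \<open>Each summand is \<open>a m\<close> times |X_m|^2/|X_m|^2, so the cross term
    depends on the exponents alone.\<close>
  have "log_grad a k 0 x \<bullet> P (Suc k) x = (\<Sum>m=3..k. a m)"
    unfolding log_grad_def inner_sum_left
  proof (rule sum.cong[OF refl])
    fix m assume m: "m \<in> {3..k}"
    then show "(a m / rsq 0 m x) *\<^sub>R P m x \<bullet> P (Suc k) x = a m"
      using pos[of m] by (auto simp: inner_proj_self rsq_def)
  qed
  then have F1: "(norm (log_grad a (Suc k) 0 x))\<^sup>2 = (norm (log_grad a k 0 x))\<^sup>2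
      + 2 * (?b / ?r\<^sup>2) * (- \<alpha> k - (real k - 2) / 2) + (?b / ?r\<^sup>2)\<^sup>2 * ?r\<^sup>2"
    unfolding H sum_a norm_add_scaleR_sq by simp
  have F2: "(?b / ?r\<^sup>2)\<^sup>2 * ?r\<^sup>2 = ?b\<^sup>2 / ?r\<^sup>2" using r by (simp add: field_simps power2_eq_square)
  have "?r\<^sup>2 / (?r\<^sup>2)\<^sup>2 = 1 / ?r\<^sup>2" using r by (simp add: field_simps power2_eq_square)
  then have F3: "real (Suc k) / ?r\<^sup>2 - 2 * ?r\<^sup>2 / (?r\<^sup>2)\<^sup>2 = (real k - 1) / ?r\<^sup>2"
    by (simp add: diff_divide_distrib add_divide_distrib)
  have F4: "ground_pot a (Suc k) 0 x = ground_pot a k 0 x - ?b * (real (Suc k) / ?r\<^sup>2 - 2 * ?r\<^sup>2 / (?r\<^sup>2)\<^sup>2)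
      - ((norm (log_grad a (Suc k) 0 x))\<^sup>2 - (norm (log_grad a k 0 x))\<^sup>2)"
    unfolding ground_pot_def ins by (simp add: rsq_def)
  have "ground_pot a (Suc k) 0 x = ground_pot a k 0 x - ?b * ((real k - 1) / ?r\<^sup>2)
     - (2 * (?b / ?r\<^sup>2) * (- \<alpha> k - (real k - 2) / 2) + ?b\<^sup>2 / ?r\<^sup>2)"
    unfolding F4 F3 F1 F2 by simp
  also have "\<dots> = ground_pot a k 0 x - (?b * (real k - 1) + 2 * ?b * (- \<alpha> k - (real k - 2) / 2) + ?b\<^sup>2) / ?r\<^sup>2"
    by (simp add: add_divide_distrib)
  also have "?b * (real k - 1) + 2 * ?b * (- \<alpha> k - (real k - 2) / 2) + ?b\<^sup>2
      = - ((\<alpha> (Suc k - 1) - 1 / 2)\<^sup>2 - (\<alpha> (Suc k))\<^sup>2)"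
  proof -
    have b: "?b = \<alpha> k - \<alpha> (Suc k) - 1 / 2" using a[of "Suc k"] step(1) by simp
    show ?thesis unfolding b by (simp add: power2_eq_square field_simps)
  qed
  finally have "ground_pot a (Suc k) 0 x = ground_pot a k 0 x + ((\<alpha> (Suc k - 1) - 1 / 2)\<^sup>2 - (\<alpha> (Suc k))\<^sup>2) / ?r\<^sup>2"
    by (simp add: minus_divide_left)
  then show ?case unfolding ins using step.IH by simp
qed

section \<open>Integrable majorants and the Hardy inequality\<close>

text \<open>An integrable majorant of the homogeneous weights: since \<open>|x\<^sub>i| \<le> |X\<^sub>m|\<close> for \<open>i \<le> m\<close>, it suffices to
  redistribute the exponents so that every coordinate gets the same \<open>c < 1\<close>.\<close>

definition majorant :: "real \<Rightarrow> nat \<Rightarrow> real ^ 'n \<Rightarrow> real" where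
  "majorant c k x = (\<Prod>i\<in>UNIV. \<bar>x $ i\<bar> powr (- (if i \<in> e ` {1..k} then c else 0)))"

lemma integrable_majorant:
  assumes "c < 1" "B \<ge> 0"
  shows "integrable lborel (\<lambda>x. indicator (cball 0 B) x * majorant c k x)"
  unfolding majorant_def using assms by (intro integrable_prod_abs_powr) auto

lemma majorant_eq:
  assumes "\<And>i. x $ i \<noteq> 0" "k \<le> n"
  shows "majorant c k x = (\<Prod>j=1..k. \<bar>x $ e j\<bar> powr (- c))"
proof -
  have inj: "inj_on e {1..k}"
    using e assms(2) by (auto simp: bij_betw_def intro: inj_on_subset)
  have "majorant c k x = (\<Prod>i\<in>UNIV. if i \<in> e ` {1..k} then \<bar>x $ i\<bar> powr (- c) else 1)"
    unfolding majorant_def using assms by (intro prod.cong) auto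
  also have "\<dots> = (\<Prod>i\<in>e ` {1..k}. \<bar>x $ i\<bar> powr (- c))"
    by (simp add: prod.If_cases)
  also have "\<dots> = (\<Prod>j=1..k. \<bar>x $ e j\<bar> powr (- c))"
    by (subst prod.reindex[OF inj]) simp
  finally show ?thesis .
qed

lemma majorant_nonneg: "majorant c k x \<ge> 0"
  unfolding majorant_def by (intro prod_nonneg) auto

text \<open>The product is the square of the regularised ground state. It is used with
  \<open>q = 2\<close>, when a potential of size 1/|X_3|^2 stands beside it, and with
  \<open>q = 0\<close>, when it stands alone. Condition \<open>A\<close> compares partial sums of
  exponents, as \<open>prod_powr_abel\<close> asks.\<close>

lemma phi_bound:
  fixes a :: "nat \<Rightarrow> real"
  assumes nz: "\<And>i. x $ i \<noteq> 0" and "\<epsilon> \<ge> 0" "3 \<le> k" "k \<le> n" "c \<ge> 0" "q \<le> 3 * c"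
    and A: "\<And>m. m \<in> {3..k} \<Longrightarrow> q - real m * c \<le> 2 * (\<Sum>j=3..m. a j)"
  shows "norm (P 3 x) powr (- q) * (\<Prod>m=3..k. rsq \<epsilon> m x powr a m) \<le>
    majorant c k x * rsq \<epsilon> k x powr ((\<Sum>j=3..k. a j) + (real k * c - q) / 2)"
proof -
  define r where "r m = norm (P m x)" for m
  \<comment> \<open>Exponents of the comparison weight, halved because \<open>rsq\<close> is a
    square. Together with |X_3|^(-q) the factor for \<open>m = 3\<close> gives |X_3|^(-3c), one
    power -c for each of the first three coordinates; every later factor gives one further
    -c.\<close>
  define b where "b m = (if m = 3 then (q - 3 * c) / 2 else - c / 2)" for m :: nat
  have abs_le: "\<bar>x $ e j\<bar> \<le> r m" if "j \<in> {1..m}" for j m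
    unfolding r_def using that by (intro abs_nth_le_norm_proj) auto
  have rpos: "r m > 0" if "m \<ge> 3" for m
    using abs_le[of m m] nz[of "e m"] that by (smt (verit) atLeastAtMost_iff le_refl le_trans one_le_numeral zero_less_abs_iff)
  have Rr: "(r m)\<^sup>2 \<le> rsq \<epsilon> m x" for m using \<open>\<epsilon> \<ge> 0\<close> by (simp add: rsq_def r_def)
  have Rpos: "rsq \<epsilon> m x > 0" if "m \<ge> 3" for m
    using Rr[of m] rpos[OF that] zero_less_power[OF rpos[OF that], of 2] by linarith
  have Rmono: "rsq \<epsilon> m x \<le> rsq \<epsilon> (Suc m) x" for m
    unfolding rsq_def using norm_proj_mono[of m "Suc m" x] by (intro add_right_mono power_mono) auto
  have B: "(\<Sum>j=3..m. b j) = (q - real m * c) / 2" if "m \<ge> 3" for m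
    using that
  proof (induction m rule: dec_induct)
    case base
    then show ?case by (simp add: b_def)
  next
    case (step m)
    then show ?case by (simp add: b_def field_simps)
  qed
  have 1: "(\<Prod>m=3..k. rsq \<epsilon> m x powr a m) \<le>
    (\<Prod>m=3..k. rsq \<epsilon> m x powr b m) * rsq \<epsilon> k x powr ((\<Sum>j=3..k. a j) - (\<Sum>j=3..k. b j))"
  proof (rule prod_powr_abel)
    show "(\<Sum>j=3..m. b j) \<le> (\<Sum>j=3..m. a j)" if "m \<in> {3..k}" for m
      using A[OF that] B[of m] that by simp
  qed (use \<open>3 \<le> k\<close> Rpos Rmono in auto)
  have 2: "(\<Prod>m=3..k. rsq \<epsilon> m x powr b m) \<le> (\<Prod>m=3..k. ((r m)\<^sup>2) powr b m)"
  proof (rule prod_mono)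
    fix m assume m: "m \<in> {3..k}"
    have "b m \<le> 0" using \<open>c \<ge> 0\<close> \<open>q \<le> 3 * c\<close> by (simp add: b_def)
    then show "0 \<le> rsq \<epsilon> m x powr b m \<and> rsq \<epsilon> m x powr b m \<le> ((r m)\<^sup>2) powr b m"
      using Rr[of m] rpos[of m] m by (auto intro!: powr_mono2')
  qed
  have 3: "r 3 powr (- q) * (\<Prod>m=3..k. ((r m)\<^sup>2) powr b m) \<le> (\<Prod>j=1..k. \<bar>x $ e j\<bar> powr (- c))"
    using \<open>3 \<le> k\<close>
  proof (induction k rule: dec_induct)
    case base
    have sq: "((r 3)\<^sup>2) powr s = r 3 powr (2 * s)" for s
      using rpos[of 3] by (simp add: powr_powr flip: powr_numeral)
    have "r 3 powr (- q) * (\<Prod>m=3..3. ((r m)\<^sup>2) powr b m) = r 3 powr (- q + 2 * b 3)"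
      by (simp add: sq flip: powr_add)
    also have "- q + 2 * b 3 = - c + - c + - c" by (simp add: b_def field_simps)
    also have "r 3 powr (- c + - c + - c) = r 3 powr (- c) * r 3 powr (- c) * r 3 powr (- c)"
      by (simp only: powr_add)
    also have "\<dots> \<le> \<bar>x $ e 1\<bar> powr (- c) * \<bar>x $ e 2\<bar> powr (- c) * \<bar>x $ e 3\<bar> powr (- c)"
      using \<open>c \<ge> 0\<close> nz by (intro mult_mono powr_mono2' abs_le) auto
    also have "\<dots> = (\<Prod>j=1..3. \<bar>x $ e j\<bar> powr (- c))"
      by (simp add: numeral_3_eq_3 numeral_2_eq_2)
    finally show ?case .
  next
    case (step k)
    have "((r (Suc k))\<^sup>2) powr b (Suc k) = r (Suc k) powr (- c)"
      using rpos[of "Suc k"] step(1) by (simp add: b_def powr_powr flip: powr_numeral)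
    also have "\<dots> \<le> \<bar>x $ e (Suc k)\<bar> powr (- c)"
      using \<open>c \<ge> 0\<close> nz by (intro powr_mono2' abs_le) auto
    finally have "(r 3 powr (- q) * (\<Prod>m=3..k. ((r m)\<^sup>2) powr b m)) * ((r (Suc k))\<^sup>2) powr b (Suc k)
      \<le> (\<Prod>j=1..k. \<bar>x $ e j\<bar> powr (- c)) * \<bar>x $ e (Suc k)\<bar> powr (- c)"
      using step.IH by (intro mult_mono) (auto intro!: prod_nonneg)
    then show ?case using step by (simp add: mult.assoc)
  qed
  have "norm (P 3 x) powr (- q) * (\<Prod>m=3..k. rsq \<epsilon> m x powr a m) \<le>
     r 3 powr (- q) * ((\<Prod>m=3..k. ((r m)\<^sup>2) powr b m) * rsq \<epsilon> k x powr ((\<Sum>j=3..k. a j) - (\<Sum>j=3..k. b j)))"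
    unfolding r_def[of 3, symmetric]
    by (intro mult_left_mono order_trans[OF 1] mult_right_mono 2) auto
  also have "\<dots> \<le> majorant c k x * rsq \<epsilon> k x powr ((\<Sum>j=3..k. a j) - (\<Sum>j=3..k. b j))"
    unfolding majorant_eq[OF nz \<open>k \<le> n\<close>] mult.assoc[symmetric] by (intro mult_right_mono 3) auto
  also have "(\<Sum>j=3..k. a j) - (\<Sum>j=3..k. b j) = (\<Sum>j=3..k. a j) + (real k * c - q) / 2"
    using B[OF \<open>3 \<le> k\<close>] by (simp add: field_simps)
  finally show ?thesis .
qed

lemma norm_proj_pos:
  assumes "\<And>i. x $ i \<noteq> 0" "3 \<le> m"
  shows "norm (P m x) > 0"
  using abs_nth_le_norm_proj[of "e 1" m x] assms(1)[of "e 1"] assms(2) zero_less_abs_iff[of "x $ e 1"]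
  by (auto intro: order_less_le_trans)

text \<open>Three coordinates share the exponent -2, so each gets -2/3 > -1. This is the place where
  codimension three makes the inverse square weight locally integrable.\<close>

lemma inverse_norm_proj_bound:
  assumes "\<And>i. x $ i \<noteq> 0"
  shows "1 / (norm (P 3 x))\<^sup>2 \<le> majorant (2/3) 3 x"
proof -
  have "norm (P 3 x) > 0" using norm_proj_pos[of x 3] assms by simp
  then have "norm (P 3 x) powr (- 2) = 1 / (norm (P 3 x))\<^sup>2" and "rsq 0 3 x > 0"
    by (simp_all add: powr_minus_divide rsq_def)
  then show ?thesis
    using phi_bound[of x 0 3 "2/3" 2 "\<lambda>_. 0"] assms n by simp
qed

lemma borel_measurable_rsq [measurable]: "rsq \<epsilon> m \<in> borel_measurable borel"
  by (intro borel_measurable_continuous_onI continuous_intros)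

lemma borel_measurable_proj [measurable]: "P m \<in> borel_measurable borel"
  by (intro borel_measurable_continuous_onI continuous_intros)

lemma borel_measurable_ground_pot [measurable]: "ground_pot a k \<epsilon> \<in> borel_measurable borel"
  unfolding ground_pot_def log_grad_def by measurable

lemma C1c_bounded:
  fixes u :: "real ^ 'n \<Rightarrow> real"
  assumes "C1c u"
  shows "\<exists>M R. 0 \<le> M \<and> 0 \<le> R \<and> (\<forall>x. (u x)\<^sup>2 \<le> indicator (cball 0 R) x * M) \<and>
    (\<forall>x. (norm (grad u x))\<^sup>2 \<le> indicator (cball 0 R) x * M)"
proof -
  note D = C1cD[OF assms]
  obtain R where R: "R > 0" "\<And>x. u x \<noteq> 0 \<or> grad u x \<noteq> 0 \<Longrightarrow> x \<in> cball 0 R"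
    using D(4) by blast
  let ?f = "\<lambda>x. (u x)\<^sup>2 + (norm (grad u x))\<^sup>2"
  have "compact (?f ` cball 0 R)"
    by (intro compact_continuous_image continuous_intros continuous_on_subset[OF D(2)] continuous_on_subset[OF D(3)]) auto
  then obtain M where "\<forall>y\<in>?f ` cball 0 R. norm y \<le> M"
    using compact_imp_bounded bounded_iff by blast
  then have M: "?f x \<le> M" if "x \<in> cball 0 R" for x
    using that by (simp add: abs_le_iff)
  have "?f 0 \<le> M" using M[of 0] R(1) by simp
  then have "0 \<le> M" using zero_le_power2[of "u 0"] zero_le_power2[of "norm (grad u 0)"] by linarith
  have "(u x)\<^sup>2 \<le> indicator (cball 0 R) x * M" "(norm (grad u x))\<^sup>2 \<le> indicator (cball 0 R) x * M" for x
  proof (atomize(full), cases "u x \<noteq> 0 \<or> grad u x \<noteq> 0")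
    case True
    then have "x \<in> cball 0 R" by (rule R)
    then show "(u x)\<^sup>2 \<le> indicator (cball 0 R) x * M \<and> (norm (grad u x))\<^sup>2 \<le> indicator (cball 0 R) x * M"
      using M[of x] zero_le_power2[of "u x"] zero_le_power2[of "norm (grad u x)"]
      by (simp add: order_trans[OF _ M[of x]])
  qed (use \<open>0 \<le> M\<close> in auto)
  then show ?thesis using \<open>0 \<le> M\<close> R(1) by (intro exI[of _ M] exI[of _ R]) auto
qed

text \<open>The nonnegative square is dropped while \<epsilon> > 0, so only the potential term has
  to pass to the limit.\<close>

lemma hardy_ground_pot:
  fixes u :: "real ^ 'n \<Rightarrow> real"
  assumes "C1c u"
  shows "(\<integral>x. ground_pot a n 0 x * (u x)\<^sup>2 \<partial>lborel) \<le> (\<integral>x. (norm (grad u x))\<^sup>2 \<partial>lborel)"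
proof -
  obtain M R where MR: "0 \<le> M" "0 \<le> R" "\<And>x. (u x)\<^sup>2 \<le> indicator (cball 0 R) x * M"
    using C1c_bounded[OF assms(1)] by blast
  have [measurable]: "u \<in> borel_measurable borel"
    using C1cD(3)[OF assms(1)] by (rule borel_measurable_continuous_onI)
  define C where "C = (\<Sum>m=3..n. \<bar>a m\<bar> * (real m + 2)) + (\<Sum>m=3..n. \<bar>a m\<bar>)\<^sup>2"
  have "C \<ge> 0" unfolding C_def by (intro add_nonneg_nonneg sum_nonneg) auto
  have "(\<lambda>N. \<integral>x. ground_pot a n (inverse (real (Suc N))) x * (u x)\<^sup>2 \<partial>lborel)
    \<longlonglongrightarrow> (\<integral>x. ground_pot a n 0 x * (u x)\<^sup>2 \<partial>lborel)"
  proof (rule integral_dominated_convergence)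
    show "integrable lborel (\<lambda>x. C * M * (indicator (cball 0 R) x * majorant (2/3) 3 x))"
      using MR by (intro integrable_mult_right integrable_majorant) auto
    show "AE x in lborel. (\<lambda>N. ground_pot a n (inverse (real (Suc N))) x * (u x)\<^sup>2) \<longlonglongrightarrow> ground_pot a n 0 x * (u x)\<^sup>2"
      using AE_all_components_nonzero
    proof eventually_elim
      case (elim x)
      then show ?case using norm_proj_pos[of x 3] by (intro tendsto_intros ground_pot_tendsto) auto
    qed
    show "AE x in lborel. norm (ground_pot a n (inverse (real (Suc N))) x * (u x)\<^sup>2) \<le> C * M * (indicator (cball 0 R) x * majorant (2/3) 3 x)" for N
      using AE_all_components_nonzero
    proof eventually_elim
      case (elim x)
      have "\<bar>ground_pot a n (inverse (real (Suc N))) x\<bar> \<le> C * (1 / (norm (P 3 x))\<^sup>2)"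
        using ground_pot_bound[of x "inverse (real (Suc N))" a n] norm_proj_pos[of x 3] elim by (simp add: C_def)
      also have "\<dots> \<le> C * majorant (2/3) 3 x"
        using inverse_norm_proj_bound[of x] elim \<open>C \<ge> 0\<close> by (intro mult_left_mono) auto
      finally have "\<bar>ground_pot a n (inverse (real (Suc N))) x\<bar> * (u x)\<^sup>2 \<le> (C * majorant (2/3) 3 x) * (indicator (cball 0 R) x * M)"
        using MR(3)[of x] \<open>C \<ge> 0\<close> majorant_nonneg by (intro mult_mono) auto
      then show ?case by (simp add: abs_mult mult_ac)
    qed
  qed measurable
  moreover have "(\<integral>x. ground_pot a n (inverse (real (Suc N))) x * (u x)\<^sup>2 \<partial>lborel) \<le> (\<integral>x. (norm (grad u x))\<^sup>2 \<partial>lborel)" for N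
  proof -
    have "0 \<le> (\<integral>x. (norm (grad u x - u x *\<^sub>R log_grad a n (inverse (real (Suc N))) x))\<^sup>2 \<partial>lborel)"
      by (intro integral_nonneg_AE) auto
    then show ?thesis
      using ground_state_identity(4)[OF assms, of "inverse (real (Suc N))" n a] by simp
  qed
  ultimately show ?thesis by (intro LIMSEQ_le_const2) auto
qed

lemma hardy_inequality:
  fixes u :: "real ^ 'n \<Rightarrow> real"
  assumes "C1c u" "\<alpha> 2 = 0"
  shows "(\<integral>x. (\<Sum>m=3..n. ((\<alpha> (m - 1) - 1 / 2)\<^sup>2 - (\<alpha> m)\<^sup>2) / (norm (P m x))\<^sup>2) * (u x)\<^sup>2 \<partial>lborel)
     \<le> (\<integral>x. (norm (grad u x))\<^sup>2 \<partial>lborel)"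
proof -
  define a where "a m = \<alpha> (m - 1) - \<alpha> m - 1 / 2" for m
  have [measurable]: "u \<in> borel_measurable borel"
    using C1cD(3)[OF assms(1)] by (rule borel_measurable_continuous_onI)
  have "(\<integral>x. (\<Sum>m=3..n. ((\<alpha> (m - 1) - 1 / 2)\<^sup>2 - (\<alpha> m)\<^sup>2) / (norm (P m x))\<^sup>2) * (u x)\<^sup>2 \<partial>lborel)
     = (\<integral>x. ground_pot a n 0 x * (u x)\<^sup>2 \<partial>lborel)"
  proof (rule integral_cong_AE)
    show "AE x in lborel. (\<Sum>m=3..n. ((\<alpha> (m - 1) - 1 / 2)\<^sup>2 - (\<alpha> m)\<^sup>2) / (norm (P m x))\<^sup>2) * (u x)\<^sup>2
        = ground_pot a n 0 x * (u x)\<^sup>2"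
      using AE_all_components_nonzero
    proof eventually_elim
      case (elim x)
      then show ?case
        using ground_pot_0[of x \<alpha> n a] norm_proj_pos[of x 3] assms n by (simp add: a_def)
    qed
  qed measurable
  then show ?thesis using hardy_ground_pot[OF assms(1)] by simp
qed

section \<open>Smooth test functions\<close>

text \<open>A class of functions closed under partial derivatives, hence consisting of smooth functions.\<close>

inductive elementary :: "real \<Rightarrow> real ^ 'n \<Rightarrow> (real ^ 'n \<Rightarrow> real) \<Rightarrow> bool" for \<epsilon> p where
  const: "elementary \<epsilon> p (\<lambda>_. c)"
| coord: "elementary \<epsilon> p (\<lambda>x. x $ i)"
| powr: "elementary \<epsilon> p (\<lambda>x. rsq \<epsilon> m x powr s)"
| bump: "elementary \<epsilon> p (\<lambda>x. flat j (1 - (norm (x - p))\<^sup>2))"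
| add: "elementary \<epsilon> p f \<Longrightarrow> elementary \<epsilon> p g \<Longrightarrow> elementary \<epsilon> p (\<lambda>x. f x + g x)"
| mult: "elementary \<epsilon> p f \<Longrightarrow> elementary \<epsilon> p g \<Longrightarrow> elementary \<epsilon> p (\<lambda>x. f x * g x)"

lemma elementary_prod: "(\<And>m. m \<in> A \<Longrightarrow> elementary \<epsilon> p (f m)) \<Longrightarrow> elementary \<epsilon> p (\<lambda>x. \<Prod>m\<in>A. f m x)"
  by (induction A rule: infinite_finite_induct) (simp_all add: elementary.const elementary.mult)

lemma has_derivative_rsq_powr:
  assumes "\<epsilon> > 0"
  shows "((\<lambda>x. rsq \<epsilon> m x powr s) has_derivative
    (\<lambda>h. 2 * (P m x \<bullet> h) * (s * rsq \<epsilon> m x powr (s - 1)))) (at x)"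
  by (rule DERIV_compose_FDERIV[OF has_real_derivative_powr[OF rsq_pos[OF assms]] has_derivative_rsq])

lemma has_derivative_bump:
  "((\<lambda>x. flat j (1 - (norm (x - p))\<^sup>2)) has_derivative
    (\<lambda>h. - 2 * ((x - p) \<bullet> h) * (flat (j + 2) (1 - (norm (x - p))\<^sup>2) - real j * flat (j + 1) (1 - (norm (x - p))\<^sup>2))))
    (at (x :: real ^ 'n))"
proof (rule DERIV_compose_FDERIV[OF DERIV_flat])
  show "((\<lambda>x. 1 - (norm (x - p))\<^sup>2) has_derivative (\<lambda>h. - 2 * ((x - p) \<bullet> h))) (at x)"
    unfolding power2_norm_eq_inner
    by (auto intro!: derivative_eq_intros simp: inner_commute fun_eq_iff)
qed

text \<open>The exponent \<open>s\<close> and the index \<open>j\<close> are free in the generators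
  because differentiation lowers the one and raises the other.\<close>

lemma elementary_has_derivative:
  assumes "\<epsilon> > 0" "elementary \<epsilon> p f"
  shows "\<exists>g. (\<forall>i. elementary \<epsilon> p (\<lambda>x. g x $ i)) \<and> (\<forall>x. (f has_derivative (\<lambda>h. g x \<bullet> h)) (at x))"
  using assms(2)
proof induction
  case (const c)
  show ?case by (rule exI[of _ "\<lambda>_. 0"]) (simp add: elementary.const)
next
  case (coord i)
  have "elementary \<epsilon> p (\<lambda>x. axis i 1 $ j)" for j by (rule elementary.const)
  then show ?case
    by (intro exI[of _ "\<lambda>_. axis i 1"]) (auto simp: inner_axis' intro: bounded_linear_imp_has_derivative bounded_linear_vec_nth)
next
  case (powr m s)
  define g where "g x = (2 * s * rsq \<epsilon> m x powr (s - 1)) *\<^sub>R P m x" for x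
  have "elementary \<epsilon> p (\<lambda>x. g x $ i)" for i
  proof -
    have "elementary \<epsilon> p (\<lambda>x. P m x $ i)"
      by (cases "i \<in> e ` {1..m}") (simp_all add: proj_nth elementary.coord elementary.const)
    then show ?thesis
      unfolding g_def vector_scaleR_component real_scaleR_def by (intro elementary.mult elementary.const elementary.powr)
  qed
  then show ?case
    using has_derivative_rsq_powr[OF assms(1), of m s]
    by (intro exI[of _ g]) (simp add: g_def mult_ac)
next
  case (bump j)
  define g where "g x = (- 2 * (flat (j + 2) (1 - (norm (x - p))\<^sup>2)
     + (- real j) * flat (j + 1) (1 - (norm (x - p))\<^sup>2))) *\<^sub>R (x - p)" for x
  have "elementary \<epsilon> p (\<lambda>x. x $ i + - (p $ i))" for i
    by (intro elementary.add elementary.coord elementary.const)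
  then have "elementary \<epsilon> p (\<lambda>x. (x - p) $ i)" for i by simp
  then have "elementary \<epsilon> p (\<lambda>x. g x $ i)" for i
    unfolding g_def vector_scaleR_component real_scaleR_def
    by (intro elementary.mult[OF elementary.mult[OF elementary.const elementary.add[OF elementary.bump elementary.mult[OF elementary.const elementary.bump]]]])
  moreover have "((\<lambda>x. flat j (1 - (norm (x - p))\<^sup>2)) has_derivative (\<lambda>h. g x \<bullet> h)) (at x)" for x
  proof -
    have "g x \<bullet> h = - 2 * ((x - p) \<bullet> h) *
        (flat (j + 2) (1 - (norm (x - p))\<^sup>2) - real j * flat (j + 1) (1 - (norm (x - p))\<^sup>2))" for h
      unfolding g_def inner_scaleR_left by algebra
    then show ?thesis using has_derivative_bump[of j p x] by (simp only:)
  qed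
  ultimately show ?case by blast
next
  case (add f1 f2)
  then obtain g1 g2 where g: "\<And>i. elementary \<epsilon> p (\<lambda>x. g1 x $ i)" "\<And>x. (f1 has_derivative (\<lambda>h. g1 x \<bullet> h)) (at x)"
    "\<And>i. elementary \<epsilon> p (\<lambda>x. g2 x $ i)" "\<And>x. (f2 has_derivative (\<lambda>h. g2 x \<bullet> h)) (at x)"
    by blast
  have "((\<lambda>x. f1 x + f2 x) has_derivative (\<lambda>h. (g1 x + g2 x) \<bullet> h)) (at x)" for x
    unfolding inner_add_left by (intro has_derivative_add g)
  then show ?case
    using g(1,3) by (intro exI[of _ "\<lambda>x. g1 x + g2 x"]) (simp add: elementary.add)
next
  case (mult f1 f2)
  then obtain g1 g2 where g: "\<And>i. elementary \<epsilon> p (\<lambda>x. g1 x $ i)" "\<And>x. (f1 has_derivative (\<lambda>h. g1 x \<bullet> h)) (at x)"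
    "\<And>i. elementary \<epsilon> p (\<lambda>x. g2 x $ i)" "\<And>x. (f2 has_derivative (\<lambda>h. g2 x \<bullet> h)) (at x)"
    by blast
  have "((\<lambda>x. f1 x * f2 x) has_derivative (\<lambda>h. (f1 x *\<^sub>R g2 x + f2 x *\<^sub>R g1 x) \<bullet> h)) (at x)" for x
    using has_derivative_mult[OF g(2,4), of x] by (simp add: inner_add_left mult.commute)
  then show ?case
    using g(1,3) mult.hyps by (intro exI[of _ "\<lambda>x. f1 x *\<^sub>R g2 x + f2 x *\<^sub>R g1 x"]) (simp add: elementary.add elementary.mult)
qed

lemma elementary_smooth:
  assumes "\<epsilon> > 0" "elementary \<epsilon> p f"
  shows "smooth f"
proof -
  have "Ck k f" for k
    using assms(2)
  proof (induction k arbitrary: f)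
    case 0
    then obtain g where "\<And>x. (f has_derivative (\<lambda>h. g x \<bullet> h)) (at x)"
      using elementary_has_derivative[OF assms(1)] by blast
    then have "continuous_on UNIV f"
      by (intro continuous_at_imp_continuous_on ballI has_derivative_continuous)
    then show ?case by simp
  next
    case (Suc k)
    then obtain g where g: "\<And>i. elementary \<epsilon> p (\<lambda>x. g x $ i)" "\<And>x. (f has_derivative (\<lambda>h. g x \<bullet> h)) (at x)"
      using elementary_has_derivative[OF assms(1)] by blast
    have "partial i f = (\<lambda>x. g x $ i)" for i
      using partial_eq[OF g(2)] by (auto simp: inner_axis)
    then show ?case using g Suc.IH by (auto simp: differentiable_def)
  qed
  then show ?thesis by (simp add: smooth_def)
qed

section \<open>Regularised ground states cut off by a bump function\<close>

definition phi :: "(nat \<Rightarrow> real) \<Rightarrow> nat \<Rightarrow> real \<Rightarrow> real ^ 'n \<Rightarrow> real" where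
  "phi a k \<epsilon> x = (\<Prod>m=3..k. rsq \<epsilon> m x powr (a m / 2))"

lemma has_derivative_phi:
  assumes "\<epsilon> > 0"
  shows "(phi a k \<epsilon> has_derivative (\<lambda>h. phi a k \<epsilon> x * (log_grad a k \<epsilon> x \<bullet> h))) (at x)"
proof (induction k)
  case 0
  then show ?case by (simp add: phi_def log_grad_def)
next
  case (Suc k)
  show ?case
  proof (cases "Suc k \<ge> 3")
    case False
    then show ?thesis by (simp add: phi_def log_grad_def)
  next
    case True
    let ?R = "rsq \<epsilon> (Suc k)" and ?s = "a (Suc k) / 2"
    have phi: "phi a (Suc k) \<epsilon> = (\<lambda>x. phi a k \<epsilon> x * ?R x powr ?s)"
      using True by (simp add: phi_def fun_eq_iff)
    have H: "log_grad a (Suc k) \<epsilon> x = log_grad a k \<epsilon> x + (a (Suc k) / ?R x) *\<^sub>R P (Suc k) x"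
      using True by (simp add: log_grad_def)
    have "?R x powr (?s - 1) = ?R x powr ?s / ?R x"
      using rsq_pos[OF assms, of "Suc k" x] by (simp add: powr_diff)
    moreover have "(phi a (Suc k) \<epsilon> has_derivative (\<lambda>h. phi a k \<epsilon> x * (2 * (P (Suc k) x \<bullet> h) * (?s * ?R x powr (?s - 1)))
        + (phi a k \<epsilon> x * (log_grad a k \<epsilon> x \<bullet> h)) * ?R x powr ?s)) (at x)"
      unfolding phi by (rule has_derivative_mult[OF Suc has_derivative_rsq_powr[OF assms]])
    ultimately show ?thesis
      unfolding H unfolding phi by (simp add: inner_add_left algebra_simps)
  qed
qed

text \<open>The standard bump exp(-1/(1 - |x - p|^2)) on the unit ball around
  \<open>p\<close>.\<close>

definition eta :: "real ^ 'n \<Rightarrow> real ^ 'n \<Rightarrow> real" where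
  "eta p x = flat 0 (1 - (norm (x - p))\<^sup>2)"

definition grad_eta :: "real ^ 'n \<Rightarrow> real ^ 'n \<Rightarrow> real ^ 'n" where
  "grad_eta p x = (- 2 * flat 2 (1 - (norm (x - p))\<^sup>2)) *\<^sub>R (x - p)"

lemma eta_le_1: "0 \<le> eta p x" "eta p x \<le> 1"
  by (auto simp: eta_def flat_def)

lemma eta_support:
  assumes "x \<notin> ball p 1"
  shows "eta p x = 0" "grad_eta p x = 0"
proof -
  have "1 \<le> norm (x - p)" using assms by (simp add: dist_norm norm_minus_commute)
  then have "1 \<le> (norm (x - p))\<^sup>2" by (rule one_le_power)
  then have "\<not> 0 < 1 - (norm (x - p))\<^sup>2" by linarith
  then show "eta p x = 0" "grad_eta p x = 0" by (simp_all add: eta_def grad_eta_def flat_def)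
qed

lemma grad_eta_bound: "\<exists>M\<ge>0. \<forall>x. (norm (grad_eta p x))\<^sup>2 \<le> M"
proof -
  have "continuous_on (cball p 1) (\<lambda>x. (norm (grad_eta p x))\<^sup>2)"
    unfolding grad_eta_def by (intro continuous_intros)
  then have "compact ((\<lambda>x. (norm (grad_eta p x))\<^sup>2) ` cball p 1)"
    by (intro compact_continuous_image) auto
  then obtain M where M: "\<forall>y\<in>(\<lambda>x. (norm (grad_eta p x))\<^sup>2) ` cball p 1. norm y \<le> M"
    using compact_imp_bounded bounded_iff by blast
  have "(norm (grad_eta p x))\<^sup>2 \<le> max M 0" for x
  proof (cases "x \<in> ball p 1")
    case True
    then have "(norm (grad_eta p x))\<^sup>2 \<in> (\<lambda>x. (norm (grad_eta p x))\<^sup>2) ` cball p 1" by simp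
    with M have "norm ((norm (grad_eta p x))\<^sup>2) \<le> M" by blast
    then show ?thesis by simp
  qed (simp add: eta_support)
  then show ?thesis by (intro exI[of _ "max M 0"]) auto
qed

text \<open>In the last claim the derivative of \<phi> cancels: the square in the ground state
  identity becomes \<phi>^2 |grad eta|^2, so bounding the energy needs only bounds on \<phi>^2 and
  the potentials.\<close>

lemma phi_eta:
  fixes a :: "nat \<Rightarrow> real" and k :: nat and p x :: "real ^ 'n"
  assumes "\<epsilon> > 0"
  defines "u \<equiv> \<lambda>x. phi a k \<epsilon> x * eta p x"
  shows "u \<in> Cc_infinity" "C1c u"
    and "grad u x - u x *\<^sub>R log_grad a k \<epsilon> x = phi a k \<epsilon> x *\<^sub>R grad_eta p x"
proof -
  have "elementary \<epsilon> p u"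
    unfolding u_def phi_def eta_def by (intro elementary.mult elementary_prod elementary.powr elementary.bump)
  then have "smooth u" using elementary_smooth assms by blast
  have "{x. u x \<noteq> 0} \<subseteq> ball p 1"
  proof
    fix x assume "x \<in> {x. u x \<noteq> 0}"
    then have "eta p x \<noteq> 0" by (simp add: u_def)
    then show "x \<in> ball p 1" using eta_support(1) by blast
  qed
  then have "bounded {x. u x \<noteq> 0}" by (rule bounded_subset[rotated]) simp
  then have "compact (closure {x. u x \<noteq> 0})" by simp
  with \<open>smooth u\<close> show u: "u \<in> Cc_infinity" by (simp add: Cc_infinity_def)
  then show "C1c u" by (rule Cc_infinity_C1c)
  have "(eta p has_derivative (\<lambda>h. grad_eta p x \<bullet> h)) (at x)"
    using has_derivative_bump[of 0 p x] unfolding eta_def grad_eta_def by (simp add: mult_ac numeral_2_eq_2)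
  from has_derivative_mult[OF has_derivative_phi[OF assms(1), of a k x] this]
  have "(u has_derivative (\<lambda>h. (phi a k \<epsilon> x *\<^sub>R grad_eta p x + u x *\<^sub>R log_grad a k \<epsilon> x) \<bullet> h)) (at x)"
    unfolding u_def by (simp add: inner_add_left mult_ac)
  moreover have "(u has_derivative (\<lambda>h. grad u x \<bullet> h)) (at x)"
    by (rule C1cD(1)[OF \<open>C1c u\<close>])
  ultimately have "(\<lambda>h. grad u x \<bullet> h) = (\<lambda>h. (phi a k \<epsilon> x *\<^sub>R grad_eta p x + u x *\<^sub>R log_grad a k \<epsilon> x) \<bullet> h)"
    using has_derivative_unique by blast
  then have "grad u x = phi a k \<epsilon> x *\<^sub>R grad_eta p x + u x *\<^sub>R log_grad a k \<epsilon> x"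
    by (metis vector_eq_rdot)
  then show "grad u x - u x *\<^sub>R log_grad a k \<epsilon> x = phi a k \<epsilon> x *\<^sub>R grad_eta p x" by simp
qed

definition V :: "(nat \<Rightarrow> real) \<Rightarrow> real ^ 'n \<Rightarrow> real" where
  "V \<beta> x = (\<Sum>m=3..n. \<beta> m / (norm (P m x))\<^sup>2)"

lemma borel_measurable_V [measurable]: "V \<beta> \<in> borel_measurable borel"
  unfolding V_def by measurable

lemma V_bound:
  assumes "norm (P 3 x) > 0"
  shows "\<bar>V \<beta> x\<bar> \<le> (\<Sum>m=3..n. \<bar>\<beta> m\<bar>) / (norm (P 3 x))\<^sup>2"
  unfolding V_def sum_divide_distrib
proof (rule order_trans[OF sum_abs sum_mono])
  fix m assume "m \<in> {3..n}"
  then have "norm (P 3 x) \<le> norm (P m x)" using norm_proj_mono by auto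
  then have "(norm (P 3 x))\<^sup>2 \<le> (norm (P m x))\<^sup>2" by (intro power_mono) auto
  moreover have "0 < (norm (P 3 x))\<^sup>2" using assms by simp
  ultimately have "\<bar>\<beta> m\<bar> / (norm (P m x))\<^sup>2 \<le> \<bar>\<beta> m\<bar> / (norm (P 3 x))\<^sup>2"
    by (intro divide_left_mono mult_pos_pos) auto
  then show "\<bar>\<beta> m / (norm (P m x))\<^sup>2\<bar> \<le> \<bar>\<beta> m\<bar> / (norm (P 3 x))\<^sup>2" by simp
qed

text \<open>Makes the subtraction of integrals in \<open>hardy_phi\<close> legitimate: a Bochner
  integral without integrability is just 0.\<close>

lemma integrable_V_sq:
  fixes u :: "real ^ 'n \<Rightarrow> real"
  assumes "C1c u"
  shows "integrable lborel (\<lambda>x. V \<beta> x * (u x)\<^sup>2)"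
proof -
  obtain M R where MR: "0 \<le> M" "0 \<le> R" "\<And>x. (u x)\<^sup>2 \<le> indicator (cball 0 R) x * M"
    using C1c_bounded[OF assms] by blast
  have [measurable]: "u \<in> borel_measurable borel"
    using C1cD(3)[OF assms] by (rule borel_measurable_continuous_onI)
  let ?C = "\<Sum>m=3..n. \<bar>\<beta> m\<bar>"
  have "?C \<ge> 0" by (intro sum_nonneg) auto
  show ?thesis
  proof (rule Bochner_Integration.integrable_bound)
    show "integrable lborel (\<lambda>x. ?C * M * (indicator (cball 0 R) x * majorant (2/3) 3 x))"
      using MR by (intro integrable_mult_right integrable_majorant) auto
    show "AE x in lborel. norm (V \<beta> x * (u x)\<^sup>2) \<le> norm (?C * M * (indicator (cball 0 R) x * majorant (2/3) 3 x))"
      using AE_all_components_nonzero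
    proof eventually_elim
      case (elim x)
      have "\<bar>V \<beta> x\<bar> \<le> ?C * (1 / (norm (P 3 x))\<^sup>2)"
        using V_bound[of x \<beta>] norm_proj_pos[of x 3] elim by simp
      also have "\<dots> \<le> ?C * majorant (2/3) 3 x"
        using inverse_norm_proj_bound[of x] elim n \<open>?C \<ge> 0\<close> by (intro mult_left_mono) auto
      finally have "\<bar>V \<beta> x\<bar> * (u x)\<^sup>2 \<le> (?C * majorant (2/3) 3 x) * (indicator (cball 0 R) x * M)"
        using MR(3)[of x] \<open>?C \<ge> 0\<close> majorant_nonneg by (intro mult_mono) auto
      also have "\<dots> \<le> norm (?C * M * (indicator (cball 0 R) x * majorant (2/3) 3 x))"
        by (simp add: mult_ac)
      finally show ?case by (simp add: abs_mult)
    qed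
  qed measurable
qed

lemma phi_sq: "(phi a k \<epsilon> x)\<^sup>2 = (\<Prod>m=3..k. rsq \<epsilon> m x powr a m)"
  unfolding phi_def power2_eq_square prod.distrib[symmetric] by (simp flip: powr_add)

lemma borel_measurable_phi [measurable]: "phi a k \<epsilon> \<in> borel_measurable borel"
  using borel_measurable_rsq unfolding phi_def by measurable

lemma borel_measurable_eta [measurable]:
  "eta p \<in> borel_measurable (borel :: (real ^ 'n) measure)"
  "grad_eta p \<in> borel_measurable (borel :: (real ^ 'n) measure)"
  unfolding eta_def grad_eta_def by (intro borel_measurable_continuous_onI continuous_intros)+

lemma phi_tendsto:
  assumes "\<And>i. x $ i \<noteq> 0"
  shows "(\<lambda>N. phi a k (inverse (real (Suc N))) x) \<longlonglongrightarrow> phi a k 0 x"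
proof -
  have lim: "(\<lambda>N. rsq (inverse (real (Suc N))) m x) \<longlonglongrightarrow> rsq 0 m x" for m
    unfolding rsq_def by (intro tendsto_intros LIMSEQ_inverse_real_of_nat)
  have "norm (P m x) > 0" if "m \<in> {3..k}" for m
    using norm_proj_pos[of x m] assms that by auto
  then have "rsq 0 m x \<noteq> 0" if "m \<in> {3..k}" for m
    using that by (fastforce simp: rsq_def)
  then show ?thesis
    unfolding phi_def by (intro tendsto_intros lim) auto
qed

lemma norm_proj_le:
  assumes "P k p = 0"
  shows "norm (P k x) \<le> norm (x - p)"
proof -
  have "P k x = P k (x - p)" using assms by (simp add: linear_diff[OF linear_proj])
  also have "norm \<dots> \<le> norm (x - p)"
    by (rule norm_le_componentwise_cart) (simp add: proj_nth)
  finally show ?thesis .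
qed

text \<open>For \<epsilon> > 0 the integral of \<open>G \<epsilon>\<close> is the deficit of the
  assumed inequality for the test function \<phi> eta, hence nonnegative. At \<epsilon> = 0 that
  function need not be smooth, so the sign is inherited through the limit.\<close>

lemma hardy_phi:
  fixes \<alpha> \<beta> a :: "nat \<Rightarrow> real" and k :: nat and p :: "real ^ 'n"
  assumes k: "3 \<le> k" "k \<le> n" and \<alpha>: "\<alpha> 2 = 0" "\<And>m. m \<in> {3..k} \<Longrightarrow> \<alpha> m < 0"
    and a: "\<And>m. m \<ge> 3 \<Longrightarrow> a m = \<alpha> (m - 1) - \<alpha> m - 1 / 2"
    and hardy: "\<And>u. u \<in> Cc_infinity \<Longrightarrow>
      (\<integral>x. V \<beta> x * (u x)\<^sup>2 \<partial>lborel) \<le> (\<integral>x. (norm (grad u x))\<^sup>2 \<partial>lborel)"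
    and p: "P k p = 0"
  defines "G \<equiv> \<lambda>\<epsilon> x. (phi a k \<epsilon> x)\<^sup>2 * ((norm (grad_eta p x))\<^sup>2 + (ground_pot a k \<epsilon> x - V \<beta> x) * (eta p x)\<^sup>2)"
  shows "integrable lborel (G 0)" "0 \<le> (\<integral>x. G 0 x \<partial>lborel)"
proof -
  define \<tau> where "\<tau> = Min ((\<lambda>m. - \<alpha> m) ` {3..k})"
  have \<tau>: "\<tau> > 0" "\<And>m. m \<in> {3..k} \<Longrightarrow> \<tau> \<le> - \<alpha> m"
    using k \<alpha> unfolding \<tau>_def by (auto simp: Min_gr_iff)
  \<comment> \<open>For \<open>q = 2\<close> the exponent condition reads
    \<open>m * (1 - c) \<le> - 2 * \<alpha> m\<close>, and strict negativity of \<alpha> leaves room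
    for some \<open>c < 1\<close>. The cap 1/3 ensures \<open>2 \<le> 3 * c\<close>.\<close>
  define c where "c = 1 - min (1 / 3) (2 * \<tau> / real n)"
  have c: "2 / 3 \<le> c" "c < 1" "1 - c \<le> 2 * \<tau> / real n"
    using \<tau>(1) n by (auto simp: c_def)
  obtain M where M: "M \<ge> 0" "\<And>x. (norm (grad_eta p x))\<^sup>2 \<le> M"
    using grad_eta_bound by blast
  \<comment> \<open>The exponent of \<open>rsq \<epsilon> k\<close> left over in
    \<open>phi_bound\<close>. It is nonnegative by \<open>exps\<close>, and
    \<open>rsq \<epsilon> k x \<le> 2\<close> on the ball, whence the constant
    \<open>2 powr s\<close>.\<close>
  define s where "s = (\<Sum>j=3..k. a j) + (real k * c - 2) / 2"
  define C where "C = (\<Sum>m=3..k. \<bar>a m\<bar> * (real m + 2)) + (\<Sum>m=3..k. \<bar>a m\<bar>)\<^sup>2"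
  define B where "B = (\<Sum>m=3..n. \<bar>\<beta> m\<bar>)"
  have CB: "C \<ge> 0" "B \<ge> 0" unfolding C_def B_def by (auto intro!: add_nonneg_nonneg sum_nonneg)
  define \<Phi> where "\<Phi> x = (M + (C + B)) * 2 powr s * (indicator (cball 0 (norm p + 1)) x * majorant c k x)" for x
  have exps: "2 - real m * c \<le> 2 * (\<Sum>j=3..m. a j)" if m: "m \<in> {3..k}" for m
  proof -
    have "real m * (1 - c) \<le> real n * (2 * \<tau> / real n)"
      using m k c by (intro mult_mono) auto
    also have "\<dots> = 2 * \<tau>" using n by simp
    also have "\<dots> \<le> - 2 * \<alpha> m" using \<tau>(2)[OF m] by simp
    finally have "real m - real m * c \<le> - 2 * \<alpha> m" by (simp add: right_diff_distrib)
    moreover have "(\<Sum>j=3..m. a j) = - \<alpha> m - (real m - 2) / 2"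
      using m by (intro sum_exponents \<alpha> a) auto
    ultimately show ?thesis by (simp add: field_simps)
  qed
  have "s \<ge> 0" using exps[of k] k by (simp add: s_def field_simps)
  have bound: "\<bar>G \<epsilon> x\<bar> \<le> \<Phi> x" if nz: "\<And>i. x $ i \<noteq> 0" and \<epsilon>: "0 \<le> \<epsilon>" "\<epsilon> \<le> 1" for \<epsilon> x
  proof (cases "x \<in> ball p 1")
    case False
    then show ?thesis
      using majorant_nonneg[of c k x] M CB by (simp add: G_def \<Phi>_def eta_support)
  next
    case True
    let ?r = "norm (P 3 x)"
    have "norm x \<le> norm p + norm (x - p)" using norm_triangle_ineq[of p "x - p"] by simp
    then have ind: "x \<in> cball 0 (norm p + 1)" using True by (simp add: dist_norm norm_minus_commute)
    have rk: "norm (P k x) \<le> 1"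
      using norm_proj_le[OF p, of x] True by (simp add: dist_norm norm_minus_commute)
    have r: "0 < ?r" "?r \<le> 1"
      using norm_proj_pos[of x 3] nz norm_proj_mono[OF k(1), of x] rk by auto
    have "rsq \<epsilon> k x \<le> 2"
      using rk \<epsilon> power_mono[OF rk, of 2] by (simp add: rsq_def)
    moreover have "0 \<le> rsq \<epsilon> k x" using \<epsilon> by (simp add: rsq_def)
    ultimately have R: "rsq \<epsilon> k x powr s \<le> 2 powr s" using \<open>s \<ge> 0\<close> by (intro powr_mono2)
    have "norm (P 3 x) powr - 2 * (phi a k \<epsilon> x)\<^sup>2 \<le> majorant c k x * rsq \<epsilon> k x powr s"
      unfolding phi_sq s_def using k c \<epsilon> nz by (intro phi_bound exps) auto
    also have "\<dots> \<le> majorant c k x * 2 powr s"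
      using R majorant_nonneg by (intro mult_left_mono) auto
    finally have ph: "(phi a k \<epsilon> x)\<^sup>2 * (1 / ?r\<^sup>2) \<le> majorant c k x * 2 powr s"
      using r by (simp add: powr_minus_divide)
    have "\<bar>ground_pot a k \<epsilon> x - V \<beta> x\<bar> \<le> (C + B) / ?r\<^sup>2"
      using ground_pot_bound[OF r(1) \<epsilon>(1), of a k] V_bound[OF r(1), of \<beta>]
      unfolding C_def[symmetric] B_def[symmetric] add_divide_distrib by linarith
    then have "\<bar>ground_pot a k \<epsilon> x - V \<beta> x\<bar> * (eta p x)\<^sup>2 \<le> (C + B) / ?r\<^sup>2 * 1"
      using eta_le_1[of p x] by (intro mult_mono) (auto simp: power_le_one)
    moreover have "M \<le> M / ?r\<^sup>2"
    proof -
      have "M * 1 \<le> M * (1 / ?r\<^sup>2)"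
        using r M(1) by (intro mult_left_mono) (auto simp: power_le_one)
      then show ?thesis by simp
    qed
    ultimately have "\<bar>(norm (grad_eta p x))\<^sup>2 + (ground_pot a k \<epsilon> x - V \<beta> x) * (eta p x)\<^sup>2\<bar> \<le> M / ?r\<^sup>2 + (C + B) / ?r\<^sup>2"
      using M(2)[of x] by (intro order_trans[OF abs_triangle_ineq] add_mono) (auto simp: abs_mult)
    also have "\<dots> = (M + (C + B)) * (1 / ?r\<^sup>2)" by (simp add: add_divide_distrib)
    finally have "\<bar>G \<epsilon> x\<bar> \<le> (phi a k \<epsilon> x)\<^sup>2 * ((M + (C + B)) * (1 / ?r\<^sup>2))"
      unfolding G_def abs_mult by (intro mult_mono) auto
    also have "\<dots> = (M + (C + B)) * ((phi a k \<epsilon> x)\<^sup>2 * (1 / ?r\<^sup>2))" by simp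
    also have "\<dots> \<le> (M + (C + B)) * (majorant c k x * 2 powr s)"
      using ph M(1) CB by (intro mult_left_mono) auto
    also have "\<dots> = \<Phi> x" using ind by (simp add: \<Phi>_def)
    finally show ?thesis .
  qed
  have meas: "G \<epsilon> \<in> borel_measurable lborel" for \<epsilon>
    using borel_measurable_ground_pot unfolding G_def by measurable
  have int\<Phi>: "integrable lborel \<Phi>"
    unfolding \<Phi>_def using c by (intro integrable_mult_right integrable_majorant) auto
  have AEb: "AE x in lborel. norm (G \<epsilon> x) \<le> \<Phi> x" if "0 \<le> \<epsilon>" "\<epsilon> \<le> 1" for \<epsilon>
    using AE_all_components_nonzero by eventually_elim (use bound that in auto)
  show "integrable lborel (G 0)"
    using int\<Phi> meas
  proof (rule Bochner_Integration.integrable_bound)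
    show "AE x in lborel. norm (G 0 x) \<le> norm (\<Phi> x)"
      using AEb[of 0] by (auto elim!: eventually_mono)
  qed
  have lim: "(\<lambda>N. \<integral>x. G (inverse (real (Suc N))) x \<partial>lborel) \<longlonglongrightarrow> (\<integral>x. G 0 x \<partial>lborel)"
  proof (rule integral_dominated_convergence[OF meas meas int\<Phi>])
    show "AE x in lborel. norm (G (inverse (real (Suc N))) x) \<le> \<Phi> x" for N
      by (rule AEb) (auto simp: inverse_le_1_iff)
    show "AE x in lborel. (\<lambda>N. G (inverse (real (Suc N))) x) \<longlonglongrightarrow> G 0 x"
      using AE_all_components_nonzero
    proof eventually_elim
      case (elim x)
      then show ?case
        unfolding G_def using norm_proj_pos[of x 3]
        by (intro tendsto_intros ground_pot_tendsto phi_tendsto) auto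
    qed
  qed
  have "0 \<le> (\<integral>x. G \<epsilon> x \<partial>lborel)" if "\<epsilon> > 0" for \<epsilon>
  proof -
    define u where "u x = phi a k \<epsilon> x * eta p x" for x
    have u: "u \<in> Cc_infinity" "C1c u" "\<And>x. grad u x - u x *\<^sub>R log_grad a k \<epsilon> x = phi a k \<epsilon> x *\<^sub>R grad_eta p x"
      using phi_eta[OF that] unfolding u_def by blast+
    note id = ground_state_identity(2-4)[OF u(2) that k(2), of a]
    have "G \<epsilon> x = (norm (grad u x - u x *\<^sub>R log_grad a k \<epsilon> x))\<^sup>2 + ground_pot a k \<epsilon> x * (u x)\<^sup>2 - V \<beta> x * (u x)\<^sup>2" for x
      unfolding u(3) by (simp add: G_def u_def power_mult_distrib algebra_simps)
    then have "(\<integral>x. G \<epsilon> x \<partial>lborel) = (\<integral>x. (norm (grad u x))\<^sup>2 \<partial>lborel) - (\<integral>x. V \<beta> x * (u x)\<^sup>2 \<partial>lborel)"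
      unfolding id(3) using id(1,2) integrable_V_sq[OF u(2), of \<beta>] by simp
    then show ?thesis using hardy[OF u(1)] by simp
  qed
  then show "0 \<le> (\<integral>x. G 0 x \<partial>lborel)"
    by (intro LIMSEQ_le_const[OF lim]) auto
qed

section \<open>Necessity\<close>

lemma inj_on_e: "inj_on e {1..n}" and range_e: "e ` {1..n} = UNIV"
  using e by (auto simp: bij_betw_def)

lemma card_e_image: "m \<le> n \<Longrightarrow> card (e ` {1..m}) = m"
  using inj_on_subset[OF inj_on_e, of "{1..m}"] by (simp add: card_image)

text \<open>On a box of scale \<open>L\<close> all |X_m|^2 lie between L^2/2 and n^2 L^2, so by
  homogeneity \<phi>^2 is \<open>L\<close> to twice its degree up to a constant. The constant, one
  factor for each of the \<open>k - 2\<close> exponents, is free of \<open>L\<close> and depends on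
  \<open>a\<close> only through \<open>S\<close>.\<close>

lemma phi_lower_bound:
  fixes a :: "nat \<Rightarrow> real"
  assumes k: "3 \<le> k" "k \<le> n" and "0 < L"
    and x: "\<And>i. i \<in> e ` {1..k} \<Longrightarrow> 3 / 4 * L \<le> x $ i \<and> x $ i \<le> L"
    and S: "\<And>m. m \<in> {3..k} \<Longrightarrow> \<bar>a m\<bar> \<le> S"
  shows "L powr (2 * (\<Sum>j=3..k. a j)) * ((2 * (real n)\<^sup>2) powr (- S)) ^ (k - 2) \<le> (phi a k 0 x)\<^sup>2"
    and "(norm (P k x))\<^sup>2 \<le> (real n)\<^sup>2 * L\<^sup>2"
proof -
  define D where "D = 2 * (real n)\<^sup>2"
  have n1: "1 \<le> (real n)\<^sup>2" using n by (intro one_le_power) auto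
  have up: "(norm (P m x))\<^sup>2 \<le> (real n)\<^sup>2 * L\<^sup>2" if "m \<in> {3..k}" for m
  proof -
    have "(norm (P m x))\<^sup>2 \<le> (\<Sum>i\<in>e ` {1..m}. L\<^sup>2)"
      unfolding norm_proj_sq
    proof (rule sum_mono)
      fix i assume "i \<in> e ` {1..m}"
      then have "i \<in> e ` {1..k}" using that by auto
      from x[OF this] show "(x $ i)\<^sup>2 \<le> L\<^sup>2" using \<open>0 < L\<close> by (intro power_mono) auto
    qed
    also have "\<dots> = real m * L\<^sup>2" using that k card_e_image[of m] by simp
    also have "\<dots> \<le> (real n)\<^sup>2 * L\<^sup>2"
    proof (rule mult_right_mono)
      have "real m \<le> real n * 1" using that k by simp
      also have "\<dots> \<le> real n * real n" using n by (intro mult_left_mono) auto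
      finally show "real m \<le> (real n)\<^sup>2" by (simp add: power2_eq_square)
    qed simp
    finally show ?thesis .
  qed
  then show "(norm (P k x))\<^sup>2 \<le> (real n)\<^sup>2 * L\<^sup>2" using k by simp
  have "L powr (2 * (\<Sum>j=3..k. a j)) * (D powr (- S)) ^ (k - 2)
     = (\<Prod>m=3..k. L powr (2 * a m) * D powr (- S))"
    using \<open>0 < L\<close> k by (simp add: prod.distrib sum_distrib_left powr_sum)
  also have "\<dots> \<le> (\<Prod>m=3..k. rsq 0 m x powr a m)"
  proof (rule prod_mono, intro conjI)
    fix m assume m: "m \<in> {3..k}"
    define y where "y = (norm (P m x))\<^sup>2 / L\<^sup>2"
    have "3 / 4 * L \<le> norm (P m x)"
    proof -
      have "e 1 \<in> e ` {1..m}" "e 1 \<in> e ` {1..k}" using m k by auto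
      then show ?thesis using x[of "e 1"] abs_nth_le_norm_proj[of "e 1" m x] by auto
    qed
    then have "(3 / 4 * L)\<^sup>2 \<le> (norm (P m x))\<^sup>2" using \<open>0 < L\<close> by (intro power_mono) auto
    then have "9 * L\<^sup>2 \<le> 16 * (norm (P m x))\<^sup>2"
      by (simp add: power_mult_distrib power_divide)
    then have "L\<^sup>2 \<le> 2 * (norm (P m x))\<^sup>2"
      using zero_le_power2[of "norm (P m x)"] by linarith
    then have "1 / 2 \<le> y" using \<open>0 < L\<close> by (simp add: y_def power_mult_distrib field_simps)
    moreover have "1 / D \<le> 1 / 2" using n1 n by (intro divide_left_mono) (auto simp: D_def)
    moreover have "y \<le> (real n)\<^sup>2" using up[OF m] \<open>0 < L\<close> by (simp add: y_def field_simps)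
    then have "y \<le> D" using n1 unfolding D_def by linarith
    ultimately have "D powr (- S) \<le> y powr a m"
      using S[OF m] n1 by (intro powr_lower_bound) (auto simp: D_def)
    then have "L powr (2 * a m) * D powr (- S) \<le> L powr (2 * a m) * y powr a m"
      by (intro mult_left_mono) auto
    also have "L powr (2 * a m) * y powr a m = (L\<^sup>2 * y) powr a m"
    proof -
      have "L powr (2 * a m) = (L\<^sup>2) powr a m"
        using \<open>0 < L\<close> by (simp add: powr_powr flip: powr_numeral)
      then show ?thesis by (simp only:) (subst powr_mult, auto simp: y_def)
    qed
    also have "L\<^sup>2 * y = rsq 0 m x" using \<open>0 < L\<close> by (simp add: y_def rsq_def)
    finally show "L powr (2 * a m) * D powr (- S) \<le> rsq 0 m x powr a m" .
  qed simp
  also have "\<dots> = (phi a k 0 x)\<^sup>2" by (simp add: phi_sq)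
  finally show "L powr (2 * (\<Sum>j=3..k. a j)) * ((2 * (real n)\<^sup>2) powr (- S)) ^ (k - 2) \<le> (phi a k 0 x)\<^sup>2"
    unfolding D_def .
qed

lemma eta_lower_bound:
  fixes x p :: "real ^ 'n"
  assumes "\<And>i. \<bar>x $ i - p $ i\<bar> \<le> 1 / (2 * real n)"
  shows "flat 0 (3 / 4) \<le> eta p x"
proof -
  have "(norm (x - p))\<^sup>2 = (\<Sum>i\<in>UNIV. (x $ i - p $ i)\<^sup>2)"
    unfolding power2_norm_eq_inner inner_vec_def by (simp add: power2_eq_square)
  also have "\<dots> \<le> (\<Sum>i\<in>(UNIV :: 'n set). (1 / (2 * real n))\<^sup>2)"
    using assms by (intro sum_mono) (simp add: power2_le_iff_abs_le)
  also have "\<dots> = real n * (1 / (2 * real n))\<^sup>2"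
    using card_e_image[of n] range_e by simp
  also have "\<dots> = 1 / (4 * real n)" using n by (simp add: power2_eq_square field_simps)
  also have "\<dots> \<le> 1 / 4" using n by (simp add: field_simps)
  finally have "3 / 4 \<le> 1 - (norm (x - p))\<^sup>2" by simp
  moreover from this have "1 / (1 - (norm (x - p))\<^sup>2) \<le> 1 / (3 / 4)"
    by (intro divide_left_mono) auto
  ultimately show ?thesis by (simp add: eta_def flat_def)
qed

text \<open>If \<open>\<beta> k\<close> were too large, test with the ground state for \<open>\<alpha> k = - 1 / N\<close>: each of
  \<open>N\<close> dyadic boxes approaching \<open>{x. P k x = 0}\<close> contributes at least a fixed negative amount to
  the energy, whereas the remaining terms stay bounded as \<open>N\<close> grows.\<close>

lemma hardy_sharp:
  fixes \<alpha> \<beta> :: "nat \<Rightarrow> real" and k :: nat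
  assumes k: "3 \<le> k" "k \<le> n" and \<alpha>: "\<alpha> 2 = 0" "\<And>m. 3 \<le> m \<Longrightarrow> m < k \<Longrightarrow> \<alpha> m < 0"
    and \<beta>: "\<And>m. 3 \<le> m \<Longrightarrow> m < k \<Longrightarrow> (\<alpha> (m - 1) - 1 / 2)\<^sup>2 - (\<alpha> m)\<^sup>2 \<le> \<beta> m"
    and hardy: "\<And>u. u \<in> Cc_infinity \<Longrightarrow>
      (\<integral>x. V \<beta> x * (u x)\<^sup>2 \<partial>lborel) \<le> (\<integral>x. (norm (grad u x))\<^sup>2 \<partial>lborel)"
  shows "\<beta> k \<le> (\<alpha> (k - 1) - 1 / 2)\<^sup>2"
proof (rule ccontr)
  assume neg: "\<not> ?thesis"
  define \<gamma> where "\<gamma> = \<beta> k - (\<alpha> (k - 1) - 1 / 2)\<^sup>2"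
  have \<gamma>: "\<gamma> > 0" using neg by (simp add: \<gamma>_def)
  define E where "E = e ` {1..k}"
  \<comment> \<open>The unit ball around \<open>p\<close> meets X_k = 0, while the coordinates past
    \<open>k\<close> exceed 1 on it; this keeps the potentials with \<open>m > k\<close>
    bounded.\<close>
  define p :: "real ^ 'n" where "p = (\<chi> i. if i \<in> E then 0 else 2)"
  have p: "P k p = 0" by (simp add: vec_eq_iff proj_nth p_def E_def)
  define h where "h = 1 / (2 * real n)"
  have h: "0 < h" "h \<le> 1" using n by (auto simp: h_def)
  define L where "L j = h / 2 ^ j" for j :: nat
  have L: "0 < L j" "L j \<le> h" for j
    using h by (auto simp: L_def field_simps)
  \<comment> \<open>The boxes are disjoint since \<open>L (j + 1) = L j / 2 < 3 / 4 * L j\<close>.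
    The side \<open>h\<close> keeps them where \<open>eta p\<close> is bounded below.\<close>
  define Box where "Box j = cbox (\<chi> i. if i \<in> E then 3 / 4 * L j else 2 - h) (\<chi> i. if i \<in> E then L j else (2::real))"
    for j
  obtain M where M: "M \<ge> 0" "\<And>x. (norm (grad_eta p x))\<^sup>2 \<le> M"
    using grad_eta_bound by blast
  define B where "B = (\<Sum>m=3..n. \<bar>\<beta> m\<bar>)"
  have "B \<ge> 0" unfolding B_def by (intro sum_nonneg) auto
  \<comment> \<open>With \<open>q = 0\<close> the exponent condition reads
    \<open>m * (1 - c) \<le> 2 - 2 * \<alpha>' m\<close>. The left side is at most 1, so this
    \<open>c\<close>, and with it \<Psi>, is independent of \<open>N\<close>.\<close>
  define c where "c = 1 - 1 / real n"
  have c: "2 / 3 \<le> c" "c < 1" using n by (auto simp: c_def field_simps)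
  define S where "S = 2 * (\<Sum>m=2..k. \<bar>\<alpha> m\<bar>) + 3"
  define q where "q = ((2 * (real n)\<^sup>2) powr (- S)) ^ (k - 2)"
  have "q > 0" using n by (simp add: q_def)
  \<comment> \<open>The factors bound from below \<open>L powr (2 / N)\<close>, the constant in
    \<phi>^2 and eta^2; n^2 comes from |X_k|^2 <= n^2 L^2.\<close>
  define \<kappa> where "\<kappa> = h\<^sup>2 / 4 * q * (flat 0 (3 / 4))\<^sup>2 / (real n)\<^sup>2"
  have "\<kappa> > 0" using h \<open>q > 0\<close> n flat_pos[of "3/4" 0] by (simp add: \<kappa>_def)
  define \<Psi> where "\<Psi> x = (M + B) * (indicator (cball 0 (norm p + 1)) x * majorant c k x)" for x
  have int\<Psi>: "integrable lborel \<Psi>"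
    unfolding \<Psi>_def using c by (intro integrable_mult_right integrable_majorant) auto

  have boxD: "\<And>i. i \<in> E \<Longrightarrow> 3 / 4 * L j \<le> x $ i \<and> x $ i \<le> L j"
    "\<And>i. \<bar>x $ i - p $ i\<bar> \<le> 1 / (2 * real n)" if "x \<in> Box j" for x j
  proof -
    have b: "(if i \<in> E then 3 / 4 * L j else 2 - h) \<le> x $ i \<and> x $ i \<le> (if i \<in> E then L j else 2)" for i
      using that by (simp add: Box_def mem_box_cart)
    show "3 / 4 * L j \<le> x $ i \<and> x $ i \<le> L j" if "i \<in> E" for i
      using b[of i] that by simp
    show "\<bar>x $ i - p $ i\<bar> \<le> 1 / (2 * real n)" for i
      using b[of i] L[of j] unfolding h_def[symmetric] p_def by (auto split: if_splits)
  qed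
  have intBox: "integrable lborel (indicator (Box j) :: real ^ 'n \<Rightarrow> real)" for j
    unfolding Box_def by (intro integrable_real_indicator emeasure_lborel_cbox_finite) auto
  have e1: "e 1 \<in> E" using k by (auto simp: E_def)
  have disj: "i = j" if "x \<in> Box i" "x \<in> Box j" for x i j
  proof -
    have "\<not> i < j" if "x \<in> Box i" "x \<in> Box j" for i j
    proof
      assume "i < j"
      have "L j \<le> h / 2 ^ Suc i"
        unfolding L_def using h \<open>i < j\<close> by (intro divide_left_mono power_increasing) auto
      also have "\<dots> = L i / 2" by (simp add: L_def)
      finally show False
        using boxD(1)[OF that(1) e1] boxD(1)[OF that(2) e1] L(1)[of i] by linarith
    qed
    then show ?thesis using that by (metis nat_neq_iff)
  qed
  have meas: "measure lborel (Box j) = (L j / 4) ^ k * h ^ card (- E)" for j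
  proof -
    have ne: "Box j \<noteq> {}"
      unfolding Box_def interval_ne_empty_cart using L[of j] h by auto
    have "measure lborel (Box j) = (\<Prod>i\<in>UNIV. (if i \<in> E then L j else 2) - (if i \<in> E then 3 / 4 * L j else 2 - h))"
      using content_cbox_cart[OF ne[unfolded Box_def]] by (simp add: Box_def)
    also have "\<dots> = (\<Prod>i\<in>UNIV. if i \<in> E then L j / 4 else h)"
      by (intro prod.cong) auto
    also have "\<dots> = (L j / 4) ^ k * h ^ card (- E)"
      using card_e_image[of k] k by (simp add: prod.If_cases E_def)
    finally show ?thesis .
  qed
  \<comment> \<open>The integrand is at least \<gamma> \<kappa>/L^k on a box of volume (L/4)^k
    h^(n-k). The scale cancels, so all boxes contribute the same \<mu>.\<close>
  define \<mu> where "\<mu> = \<gamma> * \<kappa> * h ^ card (- E) / 4 ^ k"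
  have "\<mu> > 0" using \<gamma> \<open>\<kappa> > 0\<close> h by (simp add: \<mu>_def)

  have main: "real N * \<mu> \<le> (\<integral>x. \<Psi> x \<partial>lborel)" if N: "N \<ge> 1" for N
  proof -
    define \<delta> where "\<delta> = 1 / real N"
    have \<delta>: "0 < \<delta>" "\<delta> \<le> 1" using N by (auto simp: \<delta>_def)
    define \<alpha>' where "\<alpha>' = \<alpha>(k := - \<delta>)"
    define a where "a m = \<alpha>' (m - 1) - \<alpha>' m - 1 / 2" for m
    have \<alpha>': "\<alpha>' 2 = 0" "\<And>m. m \<in> {3..k} \<Longrightarrow> \<alpha>' m < 0"
      using \<alpha> k \<delta> by (auto simp: \<alpha>'_def)
    define G where "G x = (phi a k 0 x)\<^sup>2 * ((norm (grad_eta p x))\<^sup>2 + (ground_pot a k 0 x - V \<beta> x) * (eta p x)\<^sup>2)" for x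
    have G: "integrable lborel G" "0 \<le> (\<integral>x. G x \<partial>lborel)"
      using hardy_phi[where \<alpha> = \<alpha>' and a = a and \<beta> = \<beta>, OF k \<alpha>' a_def hardy p]
      unfolding G_def by auto
    have sum_a: "(\<Sum>j=3..m. a j) = - \<alpha>' m - (real m - 2) / 2" if "m \<ge> 3" for m
      using that by (intro sum_exponents \<alpha>') (auto simp: a_def)
    have a_le: "\<bar>a m\<bar> \<le> S" if m: "m \<in> {3..k}" for m
    proof -
      have *: "\<bar>\<alpha>' j\<bar> \<le> (\<Sum>m=2..k. \<bar>\<alpha> m\<bar>) + 1" if "j \<in> {2..k}" for j
      proof (cases "j = k")
        case True
        then have "\<bar>\<alpha>' j\<bar> \<le> 1" using \<delta> by (simp add: \<alpha>'_def)
        moreover have "0 \<le> (\<Sum>m=2..k. \<bar>\<alpha> m\<bar>)" by (intro sum_nonneg) auto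
        ultimately show ?thesis by linarith
      next
        case False
        then show ?thesis using member_le_sum[of j "{2..k}" "\<lambda>m. \<bar>\<alpha> m\<bar>"] that by (simp add: \<alpha>'_def)
      qed
      have "\<bar>\<alpha>' m\<bar> \<le> (\<Sum>m=2..k. \<bar>\<alpha> m\<bar>) + 1" "\<bar>\<alpha>' (m - 1)\<bar> \<le> (\<Sum>m=2..k. \<bar>\<alpha> m\<bar>) + 1"
        using m by (intro *; auto)+
      then show ?thesis unfolding a_def S_def by linarith
    qed
    \<comment> \<open>The reason for matching \<delta> = 1/N with N boxes:
      \<open>2 powr (- 2 * j / N)\<close> stays above 1/4 for \<open>j < N\<close>, so the factor
      \<open>L j powr (2 * \<delta>)\<close> is bounded below uniformly.\<close>
    have Lpow: "h\<^sup>2 / 4 / L j ^ k \<le> L j powr (2 * (\<Sum>j=3..k. a j)) / (L j)\<^sup>2" if "j < N" for j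
    proof -
      have "h powr 2 * (1 / 2) powr 2 \<le> h powr (2 * \<delta>) * (1 / 2) powr (2 * \<delta> * real j)"
      proof (intro mult_mono powr_mono')
        have "2 * \<delta> * real j = 2 * (real j / real N)" by (simp add: \<delta>_def)
        also have "\<dots> \<le> 2 * 1" using that by (intro mult_left_mono) auto
        finally show "2 * \<delta> * real j \<le> 2" by simp
      qed (use h \<delta> in auto)
      also have "(1 / 2 :: real) powr (2 * \<delta> * real j) = ((1 / 2) ^ j) powr (2 * \<delta>)"
        by (simp add: powr_powr mult_ac flip: powr_realpow)
      also have "h powr (2 * \<delta>) * ((1 / 2) ^ j) powr (2 * \<delta>) = L j powr (2 * \<delta>)"
        unfolding L_def using h by (subst powr_mult[symmetric]) (auto simp: power_one_over)
      finally have "h\<^sup>2 / 4 \<le> L j powr (2 * \<delta>)"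
        using h by (simp add: power_divide)
      then have "h\<^sup>2 / 4 / L j ^ k \<le> L j powr (2 * \<delta>) / L j ^ k"
        using L[of j] by (intro divide_right_mono) auto
      also have "\<dots> = L j powr (2 * \<delta> - real k)"
        using L[of j] by (simp add: powr_diff powr_realpow)
      also have "2 * \<delta> - real k = 2 * (\<Sum>j=3..k. a j) - 2"
        using sum_a[OF k(1)] by (simp add: \<alpha>'_def field_simps)
      also have "L j powr (2 * (\<Sum>j=3..k. a j) - 2) = L j powr (2 * (\<Sum>j=3..k. a j)) / (L j)\<^sup>2"
        using L[of j] by (simp add: powr_diff)
      finally show ?thesis .
    qed
    have lower: "\<kappa> / L j ^ k \<le> (phi a k 0 x)\<^sup>2 * (eta p x)\<^sup>2 / (norm (P k x))\<^sup>2"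
      if "j < N" "x \<in> Box j" for j x
    proof -
      note x = boxD(1)[OF that(2), unfolded E_def]
      note pl = phi_lower_bound[OF k L(1)[of j] x a_le]
      have "(flat 0 (3 / 4))\<^sup>2 \<le> (eta p x)\<^sup>2"
        using eta_lower_bound[OF boxD(2)[OF that(2)]] flat_nonneg by (intro power_mono) auto
      moreover have "0 < norm (P k x)"
        using x[of "e 1"] abs_nth_le_norm_proj[of "e 1" k x] L(1)[of j] k by force
      ultimately have "L j powr (2 * (\<Sum>j=3..k. a j)) * q * (flat 0 (3 / 4))\<^sup>2 / ((real n)\<^sup>2 * (L j)\<^sup>2)
         \<le> (phi a k 0 x)\<^sup>2 * (eta p x)\<^sup>2 / (norm (P k x))\<^sup>2"
        using pl unfolding q_def by (intro frac_le mult_mono) auto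
      moreover have "\<kappa> / L j ^ k = (h\<^sup>2 / 4 / L j ^ k) * (q * (flat 0 (3 / 4))\<^sup>2 / (real n)\<^sup>2)"
        by (simp add: \<kappa>_def mult_ac)
      moreover have "\<dots> \<le> (L j powr (2 * (\<Sum>j=3..k. a j)) / (L j)\<^sup>2) * (q * (flat 0 (3 / 4))\<^sup>2 / (real n)\<^sup>2)"
        using Lpow[OF that(1)] \<open>q > 0\<close> by (intro mult_right_mono) auto
      ultimately show ?thesis by (simp add: mult_ac)
    qed
    define T where "T x = (\<Sum>j<N. \<gamma> * \<kappa> / L j ^ k * indicator (Box j) x)" for x
    have intT: "integrable lborel T"
      unfolding T_def by (intro Bochner_Integration.integrable_sum integrable_mult_right intBox)
    have T: "(\<integral>x. T x \<partial>lborel) = real N * \<mu>"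
    proof -
      have "(\<integral>x. T x \<partial>lborel) = (\<Sum>j<N. \<gamma> * \<kappa> / L j ^ k * measure lborel (Box j))"
        unfolding T_def using intBox by (subst Bochner_Integration.integral_sum) (auto simp: Box_def)
      also have "\<dots> = (\<Sum>j<N. \<mu>)"
      proof (rule sum.cong[OF refl])
        fix j show "\<gamma> * \<kappa> / L j ^ k * measure lborel (Box j) = \<mu>"
          unfolding meas \<mu>_def power_divide using L[of j] by simp
      qed
      finally show ?thesis by simp
    qed
    have T_le: "T x \<le> \<gamma> * ((phi a k 0 x)\<^sup>2 * (eta p x)\<^sup>2 / (norm (P k x))\<^sup>2)" for x
    proof (cases "\<exists>j<N. x \<in> Box j")
      case True
      then obtain j where j: "j < N" "x \<in> Box j" by blast
      have "T x = (\<Sum>i<N. if i = j then \<gamma> * \<kappa> / L i ^ k else 0)"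
        unfolding T_def
      proof (rule sum.cong[OF refl])
        fix i show "\<gamma> * \<kappa> / L i ^ k * indicator (Box i) x = (if i = j then \<gamma> * \<kappa> / L i ^ k else 0)"
          using disj[OF j(2), of i] j(2) by (cases "x \<in> Box i") auto
      qed
      then have "T x = \<gamma> * (\<kappa> / L j ^ k)"
        using j(1) by simp
      then show ?thesis using mult_left_mono[OF lower[OF j], of \<gamma>] \<gamma> by linarith
    next
      case False
      then have "T x = 0" by (simp add: T_def)
      then show ?thesis using \<gamma> by simp
    qed
    have "AE x in lborel. G x \<le> \<Psi> x - T x"
      using AE_all_components_nonzero
    proof eventually_elim
      case (elim x)
      show ?case
      proof (cases "x \<in> ball p 1")
        case False
        then have "T x \<le> 0" using T_le[of x] by (simp add: eta_support)
        moreover have "0 \<le> \<Psi> x" using M \<open>B \<ge> 0\<close> majorant_nonneg by (simp add: \<Psi>_def)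
        ultimately show ?thesis using False by (simp add: G_def eta_support)
      next
        case True
        then have px: "norm (x - p) < 1" by (simp add: dist_norm norm_minus_commute)
        have rpos: "norm (P m x) > 0" if "m \<ge> 3" for m using norm_proj_pos[of x m] elim that by auto
        have "norm x \<le> norm p + norm (x - p)" using norm_triangle_ineq[of p "x - p"] by simp
        then have ind: "x \<in> cball 0 (norm p + 1)" using px by simp
        have rk: "norm (P k x) \<le> 1" using norm_proj_le[OF p, of x] px by simp
        \<comment> \<open>The coefficients of the difference of potentials: nonpositive for
          \<open>m < k\<close> by assumption, at most -\<gamma> at \<open>k\<close>, and
          \<open>- \<beta> m\<close> beyond, where |X_m| >= 1.\<close>
        define D where "D m = (if m \<le> k then (\<alpha>' (m - 1) - 1 / 2)\<^sup>2 - (\<alpha>' m)\<^sup>2 else 0) - \<beta> m" for m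
        have "ground_pot a k 0 x = (\<Sum>m=3..n. (if m \<le> k then (\<alpha>' (m - 1) - 1 / 2)\<^sup>2 - (\<alpha>' m)\<^sup>2 else 0) / (norm (P m x))\<^sup>2)"
        proof -
          have "ground_pot a k 0 x = (\<Sum>m=3..k. ((\<alpha>' (m - 1) - 1 / 2)\<^sup>2 - (\<alpha>' m)\<^sup>2) / (norm (P m x))\<^sup>2)"
            using rpos[of 3] k by (intro ground_pot_0 \<alpha>') (auto simp: a_def)
          also have "\<dots> = (\<Sum>m=3..n. (if m \<le> k then (\<alpha>' (m - 1) - 1 / 2)\<^sup>2 - (\<alpha>' m)\<^sup>2 else 0) / (norm (P m x))\<^sup>2)"
            using k by (intro sum.mono_neutral_cong_left) auto
          finally show ?thesis .
        qed
        then have "ground_pot a k 0 x - V \<beta> x = (\<Sum>m=3..n. D m / (norm (P m x))\<^sup>2)"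
          by (simp add: V_def D_def diff_divide_distrib sum_subtractf)
        also have "\<dots> \<le> (\<Sum>m=3..n. \<bar>\<beta> m\<bar> + (if m = k then - \<gamma> / (norm (P k x))\<^sup>2 else 0))"
        proof (rule sum_mono)
          fix m assume m: "m \<in> {3..n}"
          consider "m < k" | "m = k" | "k < m" by linarith
          then show "D m / (norm (P m x))\<^sup>2 \<le> \<bar>\<beta> m\<bar> + (if m = k then - \<gamma> / (norm (P k x))\<^sup>2 else 0)"
          proof cases
            case 1
            then have "m - 1 \<noteq> k" by simp
            then have "D m \<le> 0" using 1 \<beta>[of m] m by (simp add: D_def \<alpha>'_def)
            then have "D m / (norm (P m x))\<^sup>2 \<le> 0" by (simp add: divide_nonpos_nonneg)
            then show ?thesis using 1 by simp
          next
            case 2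
            have "k - 1 \<noteq> k" using k by simp
            then have "D k \<le> - \<gamma>" using k by (simp add: D_def \<alpha>'_def \<gamma>_def)
            then have "D k / (norm (P k x))\<^sup>2 \<le> - \<gamma> / (norm (P k x))\<^sup>2" by (intro divide_right_mono) auto
            then show ?thesis using 2 by simp
          next
            case 3
            have "e m \<notin> E"
              unfolding E_def using m 3 k by (subst inj_on_image_mem_iff[OF inj_on_e]) auto
            then have "\<bar>x $ e m - 2\<bar> < 1"
              using component_le_norm_cart[of "x - p" "e m"] px by (simp add: p_def)
            then have "1 \<le> \<bar>x $ e m\<bar>" by linarith
            also have "\<dots> \<le> norm (P m x)" using m by (intro abs_nth_le_norm_proj) auto
            finally have "1 \<le> (norm (P m x))\<^sup>2" by (rule one_le_power)
            then have "\<bar>\<beta> m\<bar> / (norm (P m x))\<^sup>2 \<le> \<bar>\<beta> m\<bar> / 1" by (intro divide_left_mono) auto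
            moreover have "- \<beta> m / (norm (P m x))\<^sup>2 \<le> \<bar>\<beta> m\<bar> / (norm (P m x))\<^sup>2"
              by (intro divide_right_mono) auto
            ultimately show ?thesis using 3 by (simp add: D_def)
          qed
        qed
        also have "\<dots> = B - \<gamma> / (norm (P k x))\<^sup>2"
          using k by (simp add: sum.distrib B_def)
        finally have "(ground_pot a k 0 x - V \<beta> x) * (eta p x)\<^sup>2 \<le> (B - \<gamma> / (norm (P k x))\<^sup>2) * (eta p x)\<^sup>2"
          by (intro mult_right_mono) auto
        also have "\<dots> = B * (eta p x)\<^sup>2 - \<gamma> / (norm (P k x))\<^sup>2 * (eta p x)\<^sup>2" by (simp add: left_diff_distrib)
        also have "B * (eta p x)\<^sup>2 \<le> B * 1"
          using \<open>B \<ge> 0\<close> eta_le_1[of p x] by (intro mult_left_mono) (auto simp: power_le_one)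
        finally have "(norm (grad_eta p x))\<^sup>2 + (ground_pot a k 0 x - V \<beta> x) * (eta p x)\<^sup>2
            \<le> (M + B) - \<gamma> / (norm (P k x))\<^sup>2 * (eta p x)\<^sup>2"
          using M(2)[of x] by simp
        then have "G x \<le> (phi a k 0 x)\<^sup>2 * ((M + B) - \<gamma> / (norm (P k x))\<^sup>2 * (eta p x)\<^sup>2)"
          unfolding G_def by (intro mult_left_mono) auto
        also have "\<dots> = (M + B) * (phi a k 0 x)\<^sup>2 - \<gamma> * ((phi a k 0 x)\<^sup>2 * (eta p x)\<^sup>2 / (norm (P k x))\<^sup>2)"
          by (simp add: right_diff_distrib mult_ac)
        also have "\<dots> \<le> \<Psi> x - T x"
        proof (rule diff_mono[OF _ T_le])
          have ex: "0 - real m * c \<le> 2 * (\<Sum>j=3..m. a j)" if m: "m \<in> {3..k}" for m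
          proof -
            have "real m / real n \<le> 1" using m k n by simp
            then have "real m - real m * c \<le> 1" by (simp add: c_def right_diff_distrib)
            moreover have "\<alpha>' m < 0" "(\<Sum>j=3..m. a j) = - \<alpha>' m - (real m - 2) / 2"
              using \<alpha>'(2)[OF m] sum_a[of m] m by auto
            ultimately show ?thesis by (simp add: field_simps)
          qed
          have "norm (P 3 x) powr - 0 * (phi a k 0 x)\<^sup>2 \<le> majorant c k x * rsq 0 k x powr ((\<Sum>j=3..k. a j) + (real k * c - 0) / 2)"
            unfolding phi_sq using k c elim by (intro phi_bound ex) auto
          also have "\<dots> \<le> majorant c k x * 1"
          proof (intro mult_left_mono majorant_nonneg powr_le1)
            show "0 \<le> (\<Sum>j=3..k. a j) + (real k * c - 0) / 2" using ex[of k] k by (simp add: field_simps)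
            show "\<bar>rsq 0 k x\<bar> \<le> 1" using rk by (auto simp: rsq_def power_le_one)
          qed
          finally have "(phi a k 0 x)\<^sup>2 \<le> majorant c k x" using rpos[of 3] by simp
          then show "(M + B) * (phi a k 0 x)\<^sup>2 \<le> \<Psi> x"
            using ind M(1) \<open>B \<ge> 0\<close> by (simp add: \<Psi>_def mult_left_mono)
        qed
        finally show ?thesis .
      qed
    qed
    then have "(\<integral>x. G x \<partial>lborel) \<le> (\<integral>x. \<Psi> x - T x \<partial>lborel)"
      using G(1) int\<Psi> intT by (intro integral_mono_AE) auto
    also have "\<dots> = (\<integral>x. \<Psi> x \<partial>lborel) - real N * \<mu>"
      using int\<Psi> intT T by simp
    finally show ?thesis using G(2) by simp
  qed
  obtain N where "(\<integral>x. \<Psi> x \<partial>lborel) < real N * \<mu>"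
    using reals_Archimedean3[OF \<open>\<mu> > 0\<close>] by blast
  also have "\<dots> \<le> real (Suc N) * \<mu>" using \<open>\<mu> > 0\<close> by (intro mult_right_mono) auto
  finally show False using main[of "Suc N"] by simp
qed

text \<open>\<open>hardy_sharp\<close> asks for strictly negative parameters, while those of \<beta>
  may vanish. For \<tau> > 0 the parameters are strictly negative and represent the coefficients
  \<open>\<beta> m - \<tau>\<close>, which lie below \<beta>; then \<tau> -> 0. The induction is
  strong because the earlier radicands must be known to be nonnegative.\<close>

lemma hardy_necessary:
  fixes \<beta> :: "nat \<Rightarrow> real"
  assumes hardy: "\<And>u. u \<in> Cc_infinity \<Longrightarrow>
      (\<integral>x. V \<beta> x * (u x)\<^sup>2 \<partial>lborel) \<le> (\<integral>x. (norm (grad u x))\<^sup>2 \<partial>lborel)"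
    and "3 \<le> k" "k \<le> n"
  shows "\<beta> k \<le> (alpha_of \<beta> 0 (k - 1) - 1 / 2)\<^sup>2"
  using assms(2,3)
proof (induction k rule: less_induct)
  case (less k)
  have neg: "alpha_of \<beta> 0 m \<le> 0" if "3 \<le> m" "m < k" for m
    using less.IH[of m] less.prems that by (simp add: alpha_of_rec)
  have neg2: "alpha_of \<beta> 0 m \<le> 0" if "2 \<le> m" "m < k" for m
    using neg[of m] that by (cases "m = 2") auto
  \<comment> \<open>The map x -> (x - 1/2)^2 decreases for x <= 0, so moving a parameter further
    below 0 only enlarges the next radicand.\<close>
  have radicand: "(alpha_of \<beta> 0 (m - 1) - 1 / 2)\<^sup>2 \<le> (alpha_of \<beta> \<tau> (m - 1) - 1 / 2)\<^sup>2"
    if "3 \<le> m" "m < k" "alpha_of \<beta> \<tau> (m - 1) \<le> alpha_of \<beta> 0 (m - 1)" for m \<tau>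
  proof -
    have "alpha_of \<beta> 0 (m - 1) \<le> 0" using that by (intro neg2) auto
    then show ?thesis using that(3) by (subst abs_le_square_iff[symmetric]) simp
  qed
  have le: "alpha_of \<beta> \<tau> m \<le> alpha_of \<beta> 0 m" if "\<tau> > 0" "2 \<le> m" "m < k" for m \<tau>
    using that(2,3)
  proof (induction m rule: dec_induct)
    case base
    then show ?case by simp
  next
    case (step m)
    then show ?case
      using radicand[of "Suc m" \<tau>] that(1) by (simp add: alpha_of_rec[of "Suc m"])
  qed
  have \<tau>: "\<beta> k \<le> (alpha_of \<beta> \<tau> (k - 1) - 1 / 2)\<^sup>2" if "\<tau> > 0" for \<tau>
  proof (rule hardy_sharp[OF less.prems, where \<alpha> = "alpha_of \<beta> \<tau>"])
    fix m assume m: "3 \<le> m" "m < k"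
    have "alpha_of \<beta> \<tau> (m - 1) \<le> alpha_of \<beta> 0 (m - 1)"
      using m that by (intro le) auto
    then have r: "0 < (alpha_of \<beta> \<tau> (m - 1) - 1 / 2)\<^sup>2 - \<beta> m + \<tau>"
      using radicand[OF m] less.IH[of m] m less.prems that by fastforce
    show "alpha_of \<beta> \<tau> m < 0"
      using r m by (simp add: alpha_of_rec)
    show "(alpha_of \<beta> \<tau> (m - 1) - 1 / 2)\<^sup>2 - (alpha_of \<beta> \<tau> m)\<^sup>2 \<le> \<beta> m"
      using r m that by (simp add: alpha_of_rec[of m])
  qed (use hardy in auto)
  have "((\<lambda>\<tau>. alpha_of \<beta> \<tau> (k - 1)) \<longlongrightarrow> alpha_of \<beta> 0 (k - 1)) (at_right 0)"
    using continuous_on_alpha_of[of \<beta> "k - 1"]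
    by (auto simp: continuous_on_def intro: tendsto_within_subset)
  then have "((\<lambda>\<tau>. (alpha_of \<beta> \<tau> (k - 1) - 1 / 2)\<^sup>2) \<longlongrightarrow> (alpha_of \<beta> 0 (k - 1) - 1 / 2)\<^sup>2) (at_right 0)"
    by (intro tendsto_intros)
  moreover have "\<forall>\<^sub>F \<tau> in at_right 0. \<beta> k \<le> (alpha_of \<beta> \<tau> (k - 1) - 1 / 2)\<^sup>2"
    using \<tau> by (auto simp: eventually_at_filter)
  ultimately show ?case
    by (rule tendsto_lowerbound) simp
qed

end

section \<open>The two directions in terms of the given coefficients\<close>

theorem theoremA:
  fixes n :: nat and e :: "nat \<Rightarrow> 'n::finite"
  assumes "n \<ge> 3"
    and "bij_betw e {1..n} (UNIV :: 'n set)"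
  shows
    "(\<forall>\<alpha> \<beta> :: nat \<Rightarrow> real.
        \<beta> 3 = - (\<alpha> 3)\<^sup>2 + 1 / 4 \<and>
        (\<forall>m\<in>{4..n}. \<beta> m = - (\<alpha> m)\<^sup>2 + (\<alpha> (m - 1) - 1 / 2)\<^sup>2) \<longrightarrow>
        (\<forall>u \<in> (Cc_infinity :: (real ^ 'n \<Rightarrow> real) set).
           (\<integral>x. (norm (grad u x))\<^sup>2 \<partial>lborel) \<ge>
           (\<integral>x. (\<Sum>m=3..n. \<beta> m / (norm (proj_first e m x))\<^sup>2) * (u x)\<^sup>2 \<partial>lborel)))
     \<and>
     (\<forall>\<beta> :: nat \<Rightarrow> real.
        (\<forall>u \<in> (Cc_infinity :: (real ^ 'n \<Rightarrow> real) set).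
           (\<integral>x. (norm (grad u x))\<^sup>2 \<partial>lborel) \<ge>
           (\<integral>x. (\<Sum>m=3..n. \<beta> m / (norm (proj_first e m x))\<^sup>2) * (u x)\<^sup>2 \<partial>lborel)) \<longrightarrow>
        (\<exists>\<alpha> :: nat \<Rightarrow> real.
           (\<forall>m\<in>{3..n}. \<alpha> m \<le> 0) \<and>
           \<beta> 3 = - (\<alpha> 3)\<^sup>2 + 1 / 4 \<and>
           (\<forall>m\<in>{4..n}. \<beta> m = - (\<alpha> m)\<^sup>2 + (\<alpha> (m - 1) - 1 / 2)\<^sup>2)))"
proof (intro conjI allI impI ballI)
  interpret coords n e using assms by unfold_locales auto
  fix \<alpha> \<beta> :: "nat \<Rightarrow> real" and u :: "real ^ 'n \<Rightarrow> real"
  assume H: "\<beta> 3 = - (\<alpha> 3)\<^sup>2 + 1 / 4 \<and> (\<forall>m\<in>{4..n}. \<beta> m = - (\<alpha> m)\<^sup>2 + (\<alpha> (m - 1) - 1 / 2)\<^sup>2)"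
    and u: "u \<in> Cc_infinity"
  \<comment> \<open>The value at 2 is arbitrary in the given sequence; setting it to 0 turns 1/4
    into (0 - 1/2)^2 and merges the first condition with the recursion.\<close>
  define \<alpha>' where "\<alpha>' = \<alpha>(2 := 0)"
  have "\<beta> m = (\<alpha>' (m - 1) - 1 / 2)\<^sup>2 - (\<alpha>' m)\<^sup>2" if "m \<in> {3..n}" for m
  proof (cases "m = 3")
    case True
    then show ?thesis using H by (simp add: \<alpha>'_def power2_eq_square)
  next
    case False
    then show ?thesis using H that by (simp add: \<alpha>'_def)
  qed
  then have "(\<Sum>m=3..n. \<beta> m / (norm (proj_first e m x))\<^sup>2)
      = (\<Sum>m=3..n. ((\<alpha>' (m - 1) - 1 / 2)\<^sup>2 - (\<alpha>' m)\<^sup>2) / (norm (proj_first e m x))\<^sup>2)" for x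
    by (intro sum.cong) auto
  then show "(\<integral>x. (norm (grad u x))\<^sup>2 \<partial>lborel) \<ge>
      (\<integral>x. (\<Sum>m=3..n. \<beta> m / (norm (proj_first e m x))\<^sup>2) * (u x)\<^sup>2 \<partial>lborel)"
    using hardy_inequality[OF Cc_infinity_C1c[OF u], of \<alpha>'] by (simp add: \<alpha>'_def)
next
  interpret coords n e using assms by unfold_locales auto
  fix \<beta> :: "nat \<Rightarrow> real"
  assume H: "\<forall>u \<in> (Cc_infinity :: (real ^ 'n \<Rightarrow> real) set).
      (\<integral>x. (norm (grad u x))\<^sup>2 \<partial>lborel) \<ge>
      (\<integral>x. (\<Sum>m=3..n. \<beta> m / (norm (proj_first e m x))\<^sup>2) * (u x)\<^sup>2 \<partial>lborel)"
  have le: "\<beta> m \<le> (alpha_of \<beta> 0 (m - 1) - 1 / 2)\<^sup>2" if "m \<in> {3..n}" for m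
    using that H by (intro hardy_necessary) (auto simp: V_def)
  \<comment> \<open>Squaring undoes the root because \<open>le\<close> makes the radicand
    nonnegative at \<tau> = 0.\<close>
  have eq: "\<beta> m = - (alpha_of \<beta> 0 m)\<^sup>2 + (alpha_of \<beta> 0 (m - 1) - 1 / 2)\<^sup>2" if "m \<in> {3..n}" for m
    using le[OF that] that by (simp add: alpha_of_rec[of m])
  show "\<exists>\<alpha> :: nat \<Rightarrow> real. (\<forall>m\<in>{3..n}. \<alpha> m \<le> 0) \<and> \<beta> 3 = - (\<alpha> 3)\<^sup>2 + 1 / 4 \<and>
      (\<forall>m\<in>{4..n}. \<beta> m = - (\<alpha> m)\<^sup>2 + (\<alpha> (m - 1) - 1 / 2)\<^sup>2)"
  proof (intro exI[of _ "alpha_of \<beta> 0"] conjI ballI)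
    show "alpha_of \<beta> 0 m \<le> 0" if "m \<in> {3..n}" for m
      using le[OF that] that by (simp add: alpha_of_rec)
    show "\<beta> 3 = - (alpha_of \<beta> 0 3)\<^sup>2 + 1 / 4"
      using eq[of 3] n by (simp add: power2_eq_square)
    show "\<beta> m = - (alpha_of \<beta> 0 m)\<^sup>2 + (alpha_of \<beta> 0 (m - 1) - 1 / 2)\<^sup>2" if "m \<in> {4..n}" for m
      using eq[of m] that by simp
  qed
qed

end
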